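(* For any integers $2\le s\le t$, $\mathrm{ex}(n,K'_{s,t})=O(n^{3/2-\frac{1}{2s}})$ as $n\to\infty$, where the implied constant may depend on $s$ and $t$.
   Context: For a graph $H$, $\mathrm{ex}(n,H)$ is the maximum number of edges in an $n$-vertex graph containing no copy of $H$ as a subgraph. $K'_{s,t}$ denotes the 1-subdivision of the complete bipartite graph $K_{s,t}$, i.e. the graph obtained by replacing the edges of $K_{s,t}$ by internally disjoint paths of length 2. *)

theory Defs
  imports "HOL-Library.Landau_Symbols"
begin

type_synonym 'a graph = "'a set \<times> 'a set set"

abbreviation verts :: "'a graph \<Rightarrow> 'a set" where
  "verts G \<equiv> fst G"

abbreviation edges :: "'a graph \<Rightarrow> 'a set set" where
  "edges G \<equiv> snd G"

definition finite_simple_graph :: "'a graph \<Rightarrow> bool" where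
  "finite_simple_graph G \<longleftrightarrow> finite (verts G) \<and> (\<forall>e \<in> edges G. e \<subseteq> verts G \<and> card e = 2)"

(* A copy is a subgraph that need not be induced. *)
definition contains_copy :: "'a graph \<Rightarrow> 'b graph \<Rightarrow> bool" where
  "contains_copy G H \<longleftrightarrow>
     (\<exists>f. inj_on f (verts H) \<and> f ` verts H \<subseteq> verts G \<and> (\<forall>e \<in> edges H. f ` e \<in> edges G))"

(* Every finite graph is isomorphic to one whose vertices are natural numbers, so it is no
   restriction that G ranges over nat graphs.  The set is finite, and it is nonempty
   whenever H has an edge. *)
definition ex_number :: "nat \<Rightarrow> 'b graph \<Rightarrow> nat" where
  "ex_number n H =
     Max {card (edges G) | G :: nat graph.
            finite_simple_graph G \<and> card (verts G) = n \<and> \<not> contains_copy G H}"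

definition complete_bipartite :: "nat \<Rightarrow> nat \<Rightarrow> (nat + nat) graph" where
  "complete_bipartite s t =
     (Inl ` {..<s} \<union> Inr ` {..<t}, {{Inl i, Inr j} | i j. i < s \<and> j < t})"

(* The vertex Inr e is the midpoint of the path of length 2 that replaces the edge e. *)
definition one_subdivision :: "'a graph \<Rightarrow> ('a + 'a set) graph" where
  "one_subdivision H =
     (Inl ` verts H \<union> Inr ` edges H, {{Inl v, Inr e} | v e. e \<in> edges H \<and> v \<in> e})"

end

theory Submission
  imports Defs "HOL-Library.Ramsey" "HOL-Library.FuncSet"
begin

text \<open>
  Let the graph be free of the subdivision and have minimum degree at least \<open>\<delta>\<close>. Call two vertices
  light if they have boundedly many common neighbours. A large clique of non-light pairs would yield
  a copy, so by Ramsey's theorem every neighbourhood contains a positive proportion of light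
  \<open>s\<close>-sets. Consider spiders: a center \<open>z\<close>, pairwise light neighbours \<open>y\<^sub>1, \<dots>, y\<^sub>s\<close> of \<open>z\<close>, and distinct
  feet \<open>x\<^sub>i\<close> adjacent to \<open>y\<^sub>i\<close> and light to \<open>z\<close>. Weight them by the random walk started from the
  stationary distribution; their total weight is then a positive proportion of the degree sum.

  A spider is rich at \<open>i\<close> if, with \<open>y\<^sub>i\<close> and the feet other than \<open>x\<^sub>i\<close> fixed, many centers in the
  neighbourhood of \<open>y\<^sub>i\<close> are possible. Given all feet, only boundedly many spiders are nowhere rich,
  since otherwise \<open>t\<close> disjoint ones can be chosen greedily; so these have total weight
  \<open>O(n\<^sup>s / \<delta>\<^sup>2\<^sup>s\<^sup>-\<^sup>1)\<close>. Given the center \<open>z\<close> and the feet other than \<open>x\<^sub>i\<close>, only boundedly many \<open>y\<^sub>i\<close> make the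
  spider rich at \<open>i\<close>: otherwise, taking \<open>z\<close> itself as the \<open>i\<close>-th foot, one greedily picks different
  such \<open>y\<^sub>i\<close>, and for each of them a center, lightness keeping the spiders disjoint. Hence the rich
  spiders have only a proportion \<open>O(1 / \<delta>)\<close> of the degree sum. Comparing weights gives
  \<open>\<delta>\<^sup>2\<^sup>s = O(n\<^sup>s\<^sup>-\<^sup>1)\<close>. As only the minimum degree matters, no regularisation of the graph is needed.
\<close>

subsection \<open>Embedding the subdivision\<close>

definition nbrs :: "'a graph \<Rightarrow> 'a \<Rightarrow> 'a set" where
  "nbrs G v = {u. {u, v} \<in> edges G}"

lemma nbrs_sym: "u \<in> nbrs G v \<longleftrightarrow> v \<in> nbrs G u"
  by (simp add: nbrs_def insert_commute)

lemma nbrs_subset_verts: "finite_simple_graph G \<Longrightarrow> nbrs G v \<subseteq> verts G"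
  by (auto simp: nbrs_def finite_simple_graph_def)

lemma nbrs_in_verts: "finite_simple_graph G \<Longrightarrow> u \<in> nbrs G v \<Longrightarrow> v \<in> verts G"
  by (auto simp: nbrs_def finite_simple_graph_def)

lemma nbrs_irrefl: "finite_simple_graph G \<Longrightarrow> v \<notin> nbrs G v"
  by (auto simp: nbrs_def finite_simple_graph_def)

lemma finite_nbrs: "finite_simple_graph G \<Longrightarrow> finite (nbrs G v)"
  using nbrs_subset_verts finite_subset by (metis finite_simple_graph_def)

text \<open>Here \<open>x\<close> and \<open>z\<close> embed the sides of size \<open>s\<close> and
  \<open>t\<close>, and \<open>y j i\<close> is the midpoint of the edge between \<open>x i\<close>
  and \<open>z j\<close>. The other hypotheses are the distinctness conditions within and between
  these three kinds of vertices.\<close>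

lemma contains_copy_subdivisionI:
  fixes x z :: "nat \<Rightarrow> 'a" and y :: "nat \<Rightarrow> nat \<Rightarrow> 'a"
  assumes simple: "finite_simple_graph G"
    and x: "inj_on x {..<s}" "x ` {..<s} \<subseteq> verts G"
    and y: "\<And>i j. i < s \<Longrightarrow> j < t \<Longrightarrow> y j i \<in> nbrs G (z j) \<inter> nbrs G (x i)"
    and zx: "\<And>i j. i < s \<Longrightarrow> j < t \<Longrightarrow> z j \<noteq> x i"
    and yx: "\<And>i j k. i < s \<Longrightarrow> k < s \<Longrightarrow> j < t \<Longrightarrow> y j k \<noteq> x i"
    and zz: "inj_on z {..<t}"
    and yz: "\<And>i j k. i < s \<Longrightarrow> j < t \<Longrightarrow> k < t \<Longrightarrow> y j i \<noteq> z k"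
    and yy: "\<And>i j k l. i < s \<Longrightarrow> j < t \<Longrightarrow> k < s \<Longrightarrow> l < t \<Longrightarrow> y j i = y l k \<Longrightarrow> i = k \<and> j = l"
    and s: "0 < s"
  shows "contains_copy G (one_subdivision (complete_bipartite s t))"
proof -
  \<comment> \<open>A midpoint is named by an unordered pair, so its indices are recovered by
    choice; the tags \<open>Inl\<close> and \<open>Inr\<close> make them unique.\<close>
  define mid where "mid e = (case (SOME p. e = {Inl (fst p), Inr (snd p)}) of (i, j) \<Rightarrow> y j i)"
    for e :: "(nat + nat) set"
  have mid: "mid {Inl i, Inr j} = y j i" for i j
  proof -
    have "(SOME p. {Inl i, Inr j} = {Inl (fst p), Inr (snd p)}) = (i, j)"
      by (rule some_equality) (auto simp: doubleton_eq_iff)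
    then show ?thesis by (simp add: mid_def)
  qed
  define f where "f v = (case v of Inl (Inl i) \<Rightarrow> x i | Inl (Inr j) \<Rightarrow> z j | Inr e \<Rightarrow> mid e)" for v
  have f: "f (Inl (Inl i)) = x i" "f (Inl (Inr j)) = z j" "f (Inr {Inl i, Inr j}) = y j i" for i j
    by (auto simp: f_def mid)
  have vert_cases: "(\<exists>i<s. v = Inl (Inl i)) \<or> (\<exists>j<t. v = Inl (Inr j))
      \<or> (\<exists>i<s. \<exists>j<t. v = Inr {Inl i, Inr j})"
    if "v \<in> verts (one_subdivision (complete_bipartite s t))" for v
    using that unfolding one_subdivision_def complete_bipartite_def fst_conv snd_conv by blast
  have "u = v" if u: "u \<in> verts (one_subdivision (complete_bipartite s t))"
    and v: "v \<in> verts (one_subdivision (complete_bipartite s t))" and fuv: "f u = f v" for u v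
    using vert_cases[OF u]
  proof (elim disjE exE conjE)
    fix i assume i: "i < s" "u = Inl (Inl i)"
    show ?thesis
      using vert_cases[OF v] fuv i by (elim disjE exE conjE) (metis f inj_onD lessThan_iff x(1) yx zx)+
  next
    fix j assume j: "j < t" "u = Inl (Inr j)"
    show ?thesis
      using vert_cases[OF v] fuv j by (elim disjE exE conjE) (metis f inj_onD lessThan_iff zz yz zx)+
  next
    fix i j assume ij: "i < s" "j < t" "u = Inr {Inl i, Inr j}"
    show ?thesis
      using vert_cases[OF v] fuv ij by (elim disjE exE conjE) (metis f yy yz yx)+
  qed
  then have "inj_on f (verts (one_subdivision (complete_bipartite s t)))"
    by (intro inj_onI)
  moreover have "f v \<in> verts G" if v: "v \<in> verts (one_subdivision (complete_bipartite s t))" for v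
    using vert_cases[OF v]
  proof (elim disjE exE conjE)
    fix i assume "i < s" "v = Inl (Inl i)"
    then show ?thesis using x(2) by (auto simp: f)
  next
    fix j assume "j < t" "v = Inl (Inr j)"
    then show ?thesis using nbrs_in_verts[OF simple] y[OF s, of j] by (auto simp: f)
  next
    fix i j assume "i < s" "j < t" "v = Inr {Inl i, Inr j}"
    then show ?thesis using nbrs_subset_verts[OF simple] y[of i j] by (auto simp: f)
  qed
  moreover have "f ` e \<in> edges G" if "e \<in> edges (one_subdivision (complete_bipartite s t))" for e
  proof -
    from that obtain v i j where "i < s" "j < t" "v = Inl i \<or> v = Inr j" "e = {Inl v, Inr {Inl i, Inr j}}"
      unfolding one_subdivision_def complete_bipartite_def fst_conv snd_conv by blast
    then show ?thesis using y[of i j] by (auto simp: f nbrs_def insert_commute)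
  qed
  ultimately show ?thesis
    unfolding contains_copy_def by blast
qed

text \<open>Greedy construction: centers are added one at a time, each with its \<open>s\<close>
  middles, and \<open>U\<close> collects the feet and everything placed so far. There are
  \<open>s\<close> feet and at most \<open>t\<close> blocks of \<open>s + 1\<close> vertices, which
  gives the bound on \<open>U\<close>.\<close>

lemma contains_copy_if_extendable:
  fixes x :: "nat \<Rightarrow> 'a"
  assumes simple: "finite_simple_graph G" and s: "0 < s"
    and x: "inj_on x {..<s}" "x ` {..<s} \<subseteq> verts G"
    and ext: "\<And>U. finite U \<Longrightarrow> card U \<le> s + t * (s + 1) \<Longrightarrow> x ` {..<s} \<subseteq> U \<Longrightarrow>
      \<exists>z y. z \<notin> U \<and> inj_on y {..<s} \<and> (\<forall>i<s. y i \<notin> U \<and> y i \<in> nbrs G z \<inter> nbrs G (x i))"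
  shows "contains_copy G (one_subdivision (complete_bipartite s t))"
proof -
  define X where "X = x ` {..<s}"
  have X: "finite X" "card X \<le> s"
    unfolding X_def using card_image_le[of "{..<s}" x] by auto
  have "\<exists>z y. \<forall>j<k. inj_on (y j) {..<s} \<and> z j \<notin> X \<and>
      (\<forall>i<s. y j i \<notin> X \<and> y j i \<in> nbrs G (z j) \<inter> nbrs G (x i)) \<and>
      (\<forall>l<j. insert (z j) (y j ` {..<s}) \<inter> insert (z l) (y l ` {..<s}) = {})"
    if "k \<le> t" for k
    using that
  proof (induction k)
    case 0
    then show ?case by simp
  next
    case (Suc k)
    then obtain z y where zy: "\<forall>j<k. inj_on (y j) {..<s} \<and> z j \<notin> X \<and>
      (\<forall>i<s. y j i \<notin> X \<and> y j i \<in> nbrs G (z j) \<inter> nbrs G (x i)) \<and>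
      (\<forall>l<j. insert (z j) (y j ` {..<s}) \<inter> insert (z l) (y l ` {..<s}) = {})"
      by auto
    define U where "U = X \<union> (\<Union>l<k. insert (z l) (y l ` {..<s}))"
    have "finite U" using X by (simp add: U_def)
    have one: "card (insert (z l) (y l ` {..<s})) \<le> s + 1" for l
      using card_insert_le_m1[of "s+1" "y l ` {..<s}" "z l"] card_image_le[of "{..<s}" "y l"] by simp
    have "card (\<Union>l<k. insert (z l) (y l ` {..<s})) \<le> (\<Sum>l<k. card (insert (z l) (y l ` {..<s})))"
      by (rule card_UN_le) simp
    also have "\<dots> \<le> (\<Sum>l<k. s + 1)"
      by (rule sum_mono) (use one in simp)
    also have "\<dots> \<le> t * (s + 1)" 
      using Suc.prems by (simp add: mult_le_mono del: mult_Suc_right)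
    finally have "card U \<le> s + t * (s + 1)"
      unfolding U_def using X card_Un_le[of X "(\<Union>l<k. insert (z l) (y l ` {..<s}))"] by linarith
    moreover have "x ` {..<s} \<subseteq> U" by (auto simp: U_def X_def)
    ultimately obtain z' y' where z'y': "z' \<notin> U" "inj_on y' {..<s}"
      "\<forall>i<s. y' i \<notin> U \<and> y' i \<in> nbrs G z' \<inter> nbrs G (x i)"
      using ext \<open>finite U\<close> by meson
    have new: "insert z' (y' ` {..<s}) \<inter> insert (z l) (y l ` {..<s}) = {}" if "l < k" for l
      using z'y' that unfolding U_def by blast
    have newX: "z' \<notin> X" "\<forall>i<s. y' i \<notin> X"
      using z'y' by (auto simp: U_def)
    show ?case
      apply (rule exI[of _ "z(k := z')"], rule exI[of _ "y(k := y')"])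
      using zy z'y' new newX by (auto simp: less_Suc_eq)
  qed
  from this[of t] obtain z y where all: "\<forall>j<t. inj_on (y j) {..<s} \<and> z j \<notin> X \<and>
      (\<forall>i<s. y j i \<notin> X \<and> y j i \<in> nbrs G (z j) \<inter> nbrs G (x i)) \<and>
      (\<forall>l<j. insert (z j) (y j ` {..<s}) \<inter> insert (z l) (y l ` {..<s}) = {})"
    by auto
  then have zy: "\<And>j. j < t \<Longrightarrow> inj_on (y j) {..<s}" "\<And>j. j < t \<Longrightarrow> z j \<notin> X"
      "\<And>i j. i < s \<Longrightarrow> j < t \<Longrightarrow> y j i \<notin> X"
      "\<And>i j. i < s \<Longrightarrow> j < t \<Longrightarrow> y j i \<in> nbrs G (z j) \<inter> nbrs G (x i)"
    by simp_all
  have lt: "insert (z j) (y j ` {..<s}) \<inter> insert (z l) (y l ` {..<s}) = {}" if "j < t" "l < j" for j l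
    using all that by simp
  have dis: "insert (z j) (y j ` {..<s}) \<inter> insert (z l) (y l ` {..<s}) = {}" 
    if "j < t" "l < t" "l \<noteq> j" for j l
    using that lt[of j l] lt[of l j] by (metis Int_commute nat_neq_iff)
  show ?thesis
  proof (rule contains_copy_subdivisionI[of G x s t y z])
    show "inj_on z {..<t}"
      using dis by (auto simp: inj_on_def)
    show "y j i \<noteq> z k" if "i < s" "j < t" "k < t" for i j k
    proof (cases "j = k")
      case True
      \<comment> \<open>Within one block, a middle differs from its center because it is adjacent to
        it and there are no loops.\<close>
      then show ?thesis using zy(4)[OF that(1,2)] nbrs_irrefl[OF simple] by auto
    next
      case False
      then show ?thesis using dis[of j k] that by (metis IntI emptyE imageI insertCI lessThan_iff)
    qed
    show "i = k \<and> j = l" if "i < s" "j < t" "k < s" "l < t" "y j i = y l k" for i j k l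
    proof (cases "j = l")
      case True
      then show ?thesis using that inj_onD[OF zy(1)[of j]] by auto
    next
      case False
      then show ?thesis using dis[of j l] that by (metis IntI emptyE imageI insertCI lessThan_iff)
    qed
    show "z j \<noteq> x i" if "i < s" "j < t" for i j
      using zy(2)[of j] that by (auto simp: X_def)
    show "y j k \<noteq> x i" if "i < s" "k < s" "j < t" for i j k
      using zy(3)[of k j] that by (auto simp: X_def)
  qed (use zy simple s x in auto)
qed

subsection \<open>Counting lemmas\<close>

text \<open>Supersaturation: send each \<open>r\<close>-set to the pair of a chosen
  \<open>P\<close>-subset and the rest of the set. This map is injective and the rest has at most
  \<open>card W ^ (r - k)\<close> possibilities, while there are at least
  \<open>(card W / r) ^ r\<close> sets of size \<open>r\<close>.\<close>

lemma many_subsets: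
  assumes "finite W" and r: "r \<le> card W" "k \<le> r" "0 < r"
    and sub: "\<And>A. A \<subseteq> W \<Longrightarrow> card A = r \<Longrightarrow> \<exists>B\<subseteq>A. card B = k \<and> P B"
  shows "real (card W) ^ k / real r ^ r \<le> real (card {B. B \<subseteq> W \<and> card B = k \<and> P B})"
proof -
  let ?S = "{B. B \<subseteq> W \<and> card B = k \<and> P B}" and ?n = "card W"
  define g where "g A = (SOME B. B \<subseteq> A \<and> card B = k \<and> P B)" for A
  have g: "g A \<subseteq> A" "card (g A) = k" "P (g A)" if "A \<subseteq> W" "card A = r" for A
    using someI_ex[of "\<lambda>B. B \<subseteq> A \<and> card B = k \<and> P B"] sub[OF that] unfolding g_def by blast+
  have fin: "finite ?S" "finite {C. C \<subseteq> W \<and> card C = r - k}"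
    using \<open>finite W\<close> by (auto intro: finite_subset[of _ "Pow W"])
  have "card {A. A \<subseteq> W \<and> card A = r} \<le> card (?S \<times> {C. C \<subseteq> W \<and> card C = r - k})"
  proof (rule card_inj_on_le)
    show "inj_on (\<lambda>A. (g A, A - g A)) {A. A \<subseteq> W \<and> card A = r}"
    proof (rule inj_onI)
      fix A B assume AB: "A \<in> {A. A \<subseteq> W \<and> card A = r}" "B \<in> {A. A \<subseteq> W \<and> card A = r}"
        "(g A, A - g A) = (g B, B - g B)"
      then have W: "A \<subseteq> W" "card A = r" "B \<subseteq> W" "card B = r" by simp_all
      note g(1)[OF W(1,2)] g(1)[OF W(3,4)]
      then show "A = B" using AB(3) by blast
    qed
    show "(\<lambda>A. (g A, A - g A)) ` {A. A \<subseteq> W \<and> card A = r}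
        \<subseteq> ?S \<times> {C. C \<subseteq> W \<and> card C = r - k}"
    proof (rule image_subsetI)
      fix A assume "A \<in> {A. A \<subseteq> W \<and> card A = r}"
      then have A: "A \<subseteq> W" "card A = r" by simp_all
      have "finite A" using A(1) \<open>finite W\<close> finite_subset by blast
      then have "finite (g A)" using g(1)[OF A] by (rule rev_finite_subset)
      then have "card (A - g A) = r - k"
        using g[OF A] A(2) by (simp add: card_Diff_subset)
      then show "(g A, A - g A) \<in> ?S \<times> {C. C \<subseteq> W \<and> card C = r - k}"
        using g[OF A] A by auto
    qed
  qed (use fin in auto)
  also have "\<dots> = card ?S * (?n choose (r - k))"
    by (simp add: card_cartesian_product n_subsets[OF \<open>finite W\<close>])
  also have "\<dots> \<le> card ?S * ?n ^ (r - k)"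
    using r by (intro mult_left_mono binomial_le_pow) auto
  finally have "?n choose r \<le> card ?S * ?n ^ (r - k)"
    by (simp only: n_subsets[OF \<open>finite W\<close>])
  then have "real (?n choose r) \<le> real (card ?S) * real ?n ^ (r - k)"
    by (simp flip: of_nat_power of_nat_mult)
  moreover have "(real ?n / real r) ^ r \<le> real (?n choose r)"
    by (rule binomial_ge_n_over_k_pow_k) (rule r)
  moreover have "(real ?n / real r) ^ r = real ?n ^ (r - k) * (real ?n ^ k / real r ^ r)"
    unfolding power_divide using power_add[of "real ?n" "r - k" k] r(2) by simp
  ultimately have "real ?n ^ (r - k) * (real ?n ^ k / real r ^ r) \<le> real ?n ^ (r - k) * real (card ?S)"
    by (simp only: mult.commute)
  moreover have "0 < real ?n ^ (r - k)" using r by simp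
  ultimately show ?thesis by (rule mult_left_le_imp_le)
qed

text \<open>Values are chosen one index at a time, and at each step at most \<open>k\<close> of them
  are already taken. Subtraction is truncated, so the bound is merely zero if some
  \<open>A i\<close> has at most \<open>k\<close> elements.\<close>

lemma prod_diff_le_card_inj:
  fixes A :: "'i \<Rightarrow> 'b set"
  assumes "finite I" "\<And>i. i \<in> I \<Longrightarrow> finite (A i)" "card I \<le> k"
  shows "(\<Prod>i\<in>I. card (A i) - k) \<le> card {x \<in> Pi\<^sub>E I A. inj_on x I}"
  using assms
proof (induction I rule: finite_induct)
  case empty
  then show ?case by simp
next
  case (insert j I)
  let ?S = "{x \<in> Pi\<^sub>E I A. inj_on x I}"
  have k: "card I \<le> k" using insert.prems insert.hyps by simp
  have "finite (Pi\<^sub>E I A)" "finite (Pi\<^sub>E (insert j I) A)"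
    by (intro finite_PiE; simp add: insert.hyps(1) insert.prems(1))+
  then have fin: "finite ?S" "finite {x \<in> Pi\<^sub>E (insert j I) A. inj_on x (insert j I)}"
    by simp_all
  have "(\<Prod>i\<in>insert j I. card (A i) - k) = (\<Prod>i\<in>I. card (A i) - k) * (card (A j) - k)"
    using insert.hyps by simp
  also have "\<dots> \<le> card ?S * (card (A j) - k)"
    using insert.IH[OF insert.prems(1) k] by (intro mult_right_mono) auto
  also have "\<dots> = (\<Sum>x\<in>?S. card (A j) - k)" by simp
  also have "\<dots> \<le> (\<Sum>x\<in>?S. card (A j - x ` I))"
  proof (rule sum_mono)
    fix x :: "'i \<Rightarrow> 'b"
    have "card (A j) - k \<le> card (A j) - card (x ` I)"
      using card_image_le[OF insert.hyps(1), of x] k by linarith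
    also have "\<dots> \<le> card (A j - x ` I)"
      by (rule diff_card_le_card_Diff) (simp add: insert.hyps(1))
    finally show "card (A j) - k \<le> card (A j - x ` I)" .
  qed
  also have "\<dots> = card (SIGMA x:?S. A j - x ` I)"
    by (subst card_SigmaI) (use fin(1) insert.prems(1) in auto)
  also have "\<dots> \<le> card {x \<in> Pi\<^sub>E (insert j I) A. inj_on x (insert j I)}"
  proof (rule card_inj_on_le)
    show "inj_on (\<lambda>(x, a). x(j := a)) (SIGMA x:?S. A j - x ` I)"
    proof (rule inj_onI, clarsimp)
      fix x a x' a'
      assume *: "x \<in> Pi\<^sub>E I A" "x' \<in> Pi\<^sub>E I A" "x(j := a) = x'(j := a')"
      have "x i = x' i" for i
        using fun_cong[OF *(3), of i] PiE_arb[OF *(1) insert.hyps(2)] PiE_arb[OF *(2) insert.hyps(2)]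
        by (cases "i = j") simp_all
      then show "x = x' \<and> a = a'"
        using fun_cong[OF *(3), of j] by auto
    qed
    show "(\<lambda>(x, a). x(j := a)) ` (SIGMA x:?S. A j - x ` I)
        \<subseteq> {x \<in> Pi\<^sub>E (insert j I) A. inj_on x (insert j I)}"
    proof (clarify, intro conjI)
      fix x a assume x: "x \<in> Pi\<^sub>E I A" "inj_on x I" "a \<in> A j" "a \<notin> x ` I"
      show "x(j := a) \<in> Pi\<^sub>E (insert j I) A" by (rule PiE_fun_upd) (use x in auto)
      have "inj_on (x(j := a)) I" using x(2,4) by (rule inj_on_fun_updI)
      moreover have "(x(j := a)) ` I = x ` I" using insert.hyps(2) by (intro image_cong) auto
      ultimately show "inj_on (x(j := a)) (insert j I)"
        using x(4) insert.hyps(2) by simp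
    qed
  qed (use fin(2) in simp)
  finally show ?case .
qed

text \<open>Repeatedly delete a vertex of degree below \<open>k\<close>. This costs fewer than
  \<open>k\<close> edges, so the strict surplus of edges survives; the surplus also prevents the
  vertex set from becoming empty.\<close>

lemma min_degree_subgraph:
  fixes G :: "'a graph" and k :: real
  assumes "finite_simple_graph G" and "0 \<le> k" and "k * card (verts G) < card (edges G)"
  shows "\<exists>H. finite_simple_graph H \<and> verts H \<subseteq> verts G \<and> edges H \<subseteq> edges G \<and> verts H \<noteq> {} \<and>
    (\<forall>v \<in> verts H. k \<le> card (nbrs H v))"
  using assms
proof (induction "card (verts G)" arbitrary: G)
  case 0
  then have "verts G = {}" by (simp add: finite_simple_graph_def)
  then have "edges G \<subseteq> {{}}" using 0 by (auto simp: finite_simple_graph_def)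
  then have "edges G = {}" using 0 by (auto simp: finite_simple_graph_def)
  then show ?case using 0 by simp
next
  case (Suc n)
  show ?case
  proof (cases "\<forall>v \<in> verts G. k \<le> card (nbrs G v)")
    case True
    moreover have "verts G \<noteq> {}" using Suc.hyps(2) by auto
    ultimately show ?thesis using Suc.prems(1) by blast
  next
    case False
    then obtain v where v: "v \<in> verts G" "card (nbrs G v) < k" by force
    define H where "H = (verts G - {v}, {e \<in> edges G. v \<notin> e})"
    have finV: "finite (verts G)" and edge: "\<And>e. e \<in> edges G \<Longrightarrow> e \<subseteq> verts G \<and> card e = 2"
      using Suc.prems(1) by (auto simp: finite_simple_graph_def)
    have finE: "finite (edges G)"
      using finV edge by (auto intro: finite_subset[of _ "Pow (verts G)"])
    have H: "finite_simple_graph H"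
      using Suc.prems(1) by (auto simp: finite_simple_graph_def H_def)
    have cV: "card (verts H) = n" using Suc.hyps(2) v(1) finV by (simp add: H_def)
    have "edges G \<subseteq> edges H \<union> (\<lambda>u. {u, v}) ` nbrs G v"
    proof
      fix e assume e: "e \<in> edges G"
      show "e \<in> edges H \<union> (\<lambda>u. {u, v}) ` nbrs G v"
      proof (cases "v \<in> e")
        case True
        then obtain u where "e = {u, v}"
          using edge[OF e] by (auto simp: card_2_iff doubleton_eq_iff)
        then show ?thesis using e by (simp add: nbrs_def)
      qed (use e in \<open>auto simp: H_def\<close>)
    qed
    moreover have "finite (edges H)" using finE by (auto simp: H_def)
    moreover have "finite (nbrs G v)" using Suc.prems(1) by (rule finite_nbrs)
    ultimately have "card (edges G) \<le> card (edges H \<union> (\<lambda>u. {u, v}) ` nbrs G v)"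
      by (intro card_mono) auto
    also have "\<dots> \<le> card (edges H) + card ((\<lambda>u. {u, v}) ` nbrs G v)"
      by (rule card_Un_le)
    also have "\<dots> \<le> card (edges H) + card (nbrs G v)"
      using \<open>finite (nbrs G v)\<close> by (simp add: card_image_le)
    finally have "real (card (edges G)) \<le> card (edges H) + card (nbrs G v)" by linarith
    moreover have "k * real (Suc n) = k * n + k" by (simp add: algebra_simps)
    ultimately have "k * card (verts H) < card (edges H)"
      using Suc.prems(3) v(2) unfolding cV Suc.hyps(2)[symmetric] by linarith
    with Suc.hyps(1)[OF cV[symmetric] H Suc.prems(2)]
    obtain K where "finite_simple_graph K" "verts K \<subseteq> verts H" "edges K \<subseteq> edges H" "verts K \<noteq> {}"
      "\<forall>v \<in> verts K. k \<le> card (nbrs K v)"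
      by blast
    moreover have "verts H \<subseteq> verts G" "edges H \<subseteq> edges G" by (auto simp: H_def)
    ultimately show ?thesis by blast
  qed
qed

subsection \<open>Light pairs\<close>

text \<open>Distinctness is built in, so a family that is light at any two different indices is
  automatically injective.\<close>

definition light :: "'a graph \<Rightarrow> nat \<Rightarrow> 'a \<Rightarrow> 'a \<Rightarrow> bool" where
  "light G C u v \<longleftrightarrow> u \<noteq> v \<and> card (nbrs G u \<inter> nbrs G v) < C"

lemma light_sym: "light G C u v \<longleftrightarrow> light G C v u"
  by (auto simp: light_def Int_commute)

text \<open>The feet are \<open>s\<close> vertices of \<open>R\<close>. As \<open>R\<close> has one
  vertex more than \<open>U\<close> may have, a center can be found in \<open>R\<close> outside
  \<open>U\<close>. It is not light to any foot, so it shares too many neighbours with each for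
  \<open>U\<close> and the middles chosen earlier to exhaust them.\<close>

lemma contains_copy_if_heavy_clique:
  assumes simple: "finite_simple_graph G" and s: "0 < s"
    and R: "R \<subseteq> verts G" "card R = s + t * (s + 1) + 1"
    and heavy: "\<And>u v. u \<in> R \<Longrightarrow> v \<in> R \<Longrightarrow> u \<noteq> v \<Longrightarrow> \<not> light G (s + t * (s + 1) + s + 1) u v"
  shows "contains_copy G (one_subdivision (complete_bipartite s t))"
proof -
  have "finite R" using R(2) card.infinite by fastforce
  then obtain x0 where x0: "bij_betw x0 {0..<card R} R"
    using ex_bij_betw_nat_finite by blast
  have sub: "{..<s} \<subseteq> {0..<card R}" using R(2) by auto
  have x: "inj_on x0 {..<s}" "x0 ` {..<s} \<subseteq> R"
    using x0 sub by (auto simp: bij_betw_def intro: inj_on_subset)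
  show ?thesis
  proof (rule contains_copy_if_extendable[OF simple s, of x0])
    fix U assume U: "finite U" "card U \<le> s + t * (s + 1)" "x0 ` {..<s} \<subseteq> U"
    have "\<not> R \<subseteq> U" using card_mono[OF U(1), of R] U(2) R(2) by auto
    then obtain z where z: "z \<in> R" "z \<notin> U" by auto
    have "\<exists>y. inj_on y {..<k} \<and> (\<forall>i<k. y i \<notin> U \<and> y i \<in> nbrs G z \<inter> nbrs G (x0 i))" if "k \<le> s" for k
      using that
    proof (induction k)
      case 0
      then show ?case by simp
    next
      case (Suc k)
      then obtain y where y: "inj_on y {..<k}" "\<forall>i<k. y i \<notin> U \<and> y i \<in> nbrs G z \<inter> nbrs G (x0 i)"
        by auto
      have "x0 k \<in> U" "x0 k \<in> R" using U(3) x(2) Suc.prems by auto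
      then have "z \<noteq> x0 k" using z by auto
      then have "s + t * (s + 1) + s + 1 \<le> card (nbrs G z \<inter> nbrs G (x0 k))"
        using heavy[OF z(1) \<open>x0 k \<in> R\<close>] by (simp add: light_def)
      moreover have "card (U \<union> y ` {..<k}) \<le> s + t * (s + 1) + s"
        using card_Un_le[of U "y ` {..<k}"] card_image_le[of "{..<k}" y] U(2) Suc.prems by simp
      ultimately have "\<not> nbrs G z \<inter> nbrs G (x0 k) \<subseteq> U \<union> y ` {..<k}"
        using card_mono[of "U \<union> y ` {..<k}" "nbrs G z \<inter> nbrs G (x0 k)"] U(1) by auto
      then obtain w where w: "w \<in> nbrs G z \<inter> nbrs G (x0 k)" "w \<notin> U" "w \<notin> y ` {..<k}" by auto
      have "inj_on (y(k := w)) {..<Suc k}"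
        using inj_on_fun_updI[OF y(1) w(3)] w(3) by (simp add: lessThan_Suc)
      moreover have "\<forall>i<Suc k. (y(k := w)) i \<notin> U \<and> (y(k := w)) i \<in> nbrs G z \<inter> nbrs G (x0 i)"
        using y(2) w by (simp add: less_Suc_eq)
      ultimately show ?case by blast
    qed
    then show "\<exists>z y. z \<notin> U \<and> inj_on y {..<s} \<and> (\<forall>i<s. y i \<notin> U \<and> y i \<in> nbrs G z \<inter> nbrs G (x0 i))"
      using z(2) by blast
  qed (use x R in auto)
qed

text \<open>Ramsey's theorem for the graph of non-light pairs: every \<open>r\<close>-set contains a
  heavy clique, which is impossible here, or \<open>s\<close> pairwise light vertices, and
  \<open>many_subsets\<close> turns this into a positive proportion. The number \<open>r\<close> is
  fixed before \<open>G\<close>, so the constants built from it are uniform in the graph.\<close>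

lemma many_light_sets:
  assumes s: "0 < s"
  obtains r where "0 < r"
    "\<And>(G :: 'a graph) W k. finite_simple_graph G \<Longrightarrow>
       \<not> contains_copy G (one_subdivision (complete_bipartite s t)) \<Longrightarrow>
       W \<subseteq> verts G \<Longrightarrow> r \<le> card W \<Longrightarrow> k \<le> s \<Longrightarrow>
       real (card W) ^ k / real r ^ r \<le> real (card {B. B \<subseteq> W \<and> card B = k \<and>
         (\<forall>u \<in> B. \<forall>v \<in> B. u \<noteq> v \<longrightarrow> light G (s + t * (s + 1) + s + 1) u v)})"
proof -
  let ?C = "s + t * (s + 1) + s + 1" and ?q = "s + t * (s + 1) + 1"
  obtain r0 where r0: "\<And>(V :: 'a set) E. finite V \<and> r0 \<le> card V \<Longrightarrow>
      \<exists>R\<subseteq>V. card R = ?q \<and> clique R E \<or> card R = s \<and> indep R E"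
    using ramsey2[of ?q s, where 'a = 'a] by blast
  define r where "r = max s r0"
  show ?thesis
  proof (rule that[of r])
    show "0 < r" using s by (auto simp: r_def)
    fix G :: "'a graph" and W k
    assume simple: "finite_simple_graph G"
      and free: "\<not> contains_copy G (one_subdivision (complete_bipartite s t))"
      and W: "W \<subseteq> verts G" "r \<le> card W" and k: "k \<le> s"
    have "finite W" using W(1) simple finite_subset by (auto simp: finite_simple_graph_def)
    show "real (card W) ^ k / real r ^ r \<le> real (card {B. B \<subseteq> W \<and> card B = k \<and>
         (\<forall>u \<in> B. \<forall>v \<in> B. u \<noteq> v \<longrightarrow> light G ?C u v)})"
    proof (rule many_subsets[OF \<open>finite W\<close> W(2)])
      show "k \<le> r" "0 < r" using s k by (auto simp: r_def)
      fix A assume A: "A \<subseteq> W" "card A = r"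
      define E where "E = {{u, v} | u v. \<not> light G ?C u v}"
      have E: "{u, v} \<in> E \<longleftrightarrow> \<not> light G ?C u v" for u v
        using light_sym[of G ?C u v] unfolding E_def by (auto simp: doubleton_eq_iff)
      have "finite A" using A(1) \<open>finite W\<close> finite_subset by blast
      moreover have "r0 \<le> card A" using A(2) by (simp add: r_def)
      ultimately obtain R where R: "R \<subseteq> A" "card R = ?q \<and> clique R E \<or> card R = s \<and> indep R E"
        using r0[of A E] by blast
      have "\<not> (card R = ?q \<and> clique R E)"
      proof
        assume "card R = ?q \<and> clique R E"
        then have "card R = ?q" "\<And>u v. u \<in> R \<Longrightarrow> v \<in> R \<Longrightarrow> u \<noteq> v \<Longrightarrow> \<not> light G ?C u v"
          unfolding clique_def E by blast+
        moreover have "R \<subseteq> verts G" using R(1) A(1) W(1) by blast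
        ultimately show False
          using contains_copy_if_heavy_clique[OF simple s] free by blast
      qed
      then have R': "card R = s" "indep R E" using R(2) by auto
      then obtain B where "B \<subseteq> R" "card B = k"
        using k obtain_subset_with_card_n by metis
      then show "\<exists>B\<subseteq>A. card B = k \<and> (\<forall>u \<in> B. \<forall>v \<in> B. u \<noteq> v \<longrightarrow> light G ?C u v)"
        using R(1) R'(2) unfolding indep_def E by blast
    qed
  qed
qed

subsection \<open>Total weight of the spiders\<close>

locale light_graph =
  fixes G :: "'a graph" and s C :: nat and \<delta> :: real
  assumes simple: "finite_simple_graph G"
    and s: "2 \<le> s"
    and degree: "\<And>v. v \<in> verts G \<Longrightarrow> \<delta> \<le> real (card (nbrs G v))"
    and \<delta>: "0 < \<delta>"
begin

abbreviation "V \<equiv> verts G"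
abbreviation "N \<equiv> nbrs G"
abbreviation "d v \<equiv> real (card (N v))"
abbreviation "lt \<equiv> light G C"

text \<open>A leg may return to \<open>z\<close>. Admitting this makes the probabilities of the
  two-step walks from \<open>z\<close> sum to exactly 1; \<open>spiders\<close> excludes it through
  lightness of the feet to \<open>z\<close>.\<close>

definition legs :: "'a \<Rightarrow> ('a \<times> 'a) set" where
  "legs z = Sigma (N z) N"

text \<open>A spider with center \<open>z\<close> is stored as the function \<open>i \<mapsto> (y\<^sub>i, x\<^sub>i)\<close>.\<close>

definition spiders :: "'a \<Rightarrow> (nat \<Rightarrow> 'a \<times> 'a) set" where
  "spiders z = {l \<in> {..<s} \<rightarrow>\<^sub>E legs z. inj_on (snd \<circ> l) {..<s} \<and> (\<forall>i<s. lt z (snd (l i))) \<and>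
     (\<forall>i<s. \<forall>j<s. i \<noteq> j \<longrightarrow> lt (fst (l i)) (fst (l j)))}"

text \<open>The factor \<open>d z\<close> is the unnormalised stationary measure of the random walk;
  each factor of the product is the probability that a two-step walk from \<open>z\<close> follows
  the given leg, the \<open>s\<close> walks being independent.\<close>

definition weight :: "'a \<Rightarrow> (nat \<Rightarrow> 'a \<times> 'a) \<Rightarrow> real" where
  "weight z l = d z * (\<Prod>i<s. 1 / (d z * d (fst (l i))))"

lemma finV: "finite V"
  using simple by (simp add: finite_simple_graph_def)

lemma finN: "finite (N v)"
  by (rule finite_nbrs[OF simple])

lemma N_verts: "u \<in> N v \<Longrightarrow> u \<in> V"
  using nbrs_subset_verts[OF simple] by blast

lemma d_pos: "v \<in> V \<Longrightarrow> 0 < d v"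
  using degree[of v] \<delta> by linarith

lemma finite_legs: "finite (legs z)"
  by (simp add: legs_def finN)

lemma finite_spiders: "finite (spiders z)"
  unfolding spiders_def using finite_PiE[of "{..<s}" "\<lambda>_. legs z"] finite_legs by simp

lemma weight_nonneg: "0 \<le> weight z l"
  by (simp add: weight_def prod_nonneg)

lemma leg_mem:
  assumes "l \<in> spiders z" "i < s"
  shows "fst (l i) \<in> N z" "snd (l i) \<in> N (fst (l i))" "fst (l i) \<in> V" "snd (l i) \<in> V"
proof -
  have "l i \<in> legs z" using assms by (auto simp: spiders_def)
  then show "fst (l i) \<in> N z" "snd (l i) \<in> N (fst (l i))" "fst (l i) \<in> V" "snd (l i) \<in> V"
    by (auto simp: legs_def intro: N_verts)
qed

text \<open>The first step of the walk lands in \<open>R\<close> with probability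
  \<open>card R / d z\<close>, and the second step is unrestricted.\<close>

lemma sum_legs:
  assumes "z \<in> V" "R \<subseteq> N z"
  shows "(\<Sum>p \<in> Sigma R N. 1 / (d z * d (fst p))) = real (card R) / d z"
proof -
  have "(\<Sum>p \<in> Sigma R N. 1 / (d z * d (fst p))) = (\<Sum>y\<in>R. \<Sum>x\<in>N y. 1 / (d z * d y))"
    using assms(2) finN finite_subset[of R] by (subst sum.Sigma) (auto simp: case_prod_beta)
  also have "\<dots> = (\<Sum>y\<in>R. 1 / d z)"
  proof (rule sum.cong)
    fix y assume "y \<in> R"
    then have "0 < d y" using assms(2) N_verts d_pos by blast
    then show "(\<Sum>x\<in>N y. 1 / (d z * d y)) = 1 / d z" by simp
  qed simp
  finally show ?thesis by simp
qed

end

section \<open>Lower bound for the total weight, from an abundance of light sets\<close>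

locale light_rich_graph = light_graph +
  fixes r :: nat
  assumes r: "0 < r"
    and many_light: "\<And>W k. W \<subseteq> V \<Longrightarrow> r \<le> card W \<Longrightarrow> k \<le> s \<Longrightarrow>
       real (card W) ^ k / real r ^ r \<le> real (card {B. B \<subseteq> W \<and> card B = k \<and>
         (\<forall>u \<in> B. \<forall>v \<in> B. u \<noteq> v \<longrightarrow> lt u v)})"
begin

text \<open>Half the density supplied by \<open>many_light\<close>, so that the other half can be
  given up when averaging.\<close>

definition c :: real where "c = 1 / (2 * real r ^ r)"

text \<open>The middles from which a constant proportion of second steps ends at a vertex light to
  \<open>z\<close>.\<close>

definition good :: "'a \<Rightarrow> 'a set" where
  "good z = {y \<in> N z. c * d y \<le> card {x \<in> N y. lt z x}}"

lemma c_pos: "0 < c" and c_le: "c \<le> 1"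
proof -
  show "0 < c" using r by (simp add: c_def)
  have "1 \<le> real r ^ r" using r by (intro one_le_power) linarith
  then show "c \<le> 1" by (simp add: c_def divide_simps)
qed

text \<open>The neighbourhood of \<open>y\<close> has at least \<open>2 * c * d y ^ 2\<close> light
  pairs. Those \<open>z\<close> with \<open>y\<close> outside \<open>good z\<close> account for at
  most \<open>c * d y\<close> each, hence \<open>c * d y ^ 2\<close> in all; the remaining pairs
  need at least \<open>c * d y\<close> further \<open>z\<close>, as each has at most
  \<open>d y\<close> partners.\<close>

lemma card_good_ge:
  assumes y: "y \<in> V" and dy: "real r \<le> d y"
  shows "c * d y \<le> card {z \<in> N y. y \<in> good z}"
proof -
  let ?f = "\<lambda>z. card {x \<in> N y. lt z x}"
  let ?T = "{B. B \<subseteq> N y \<and> card B = 2 \<and> (\<forall>u \<in> B. \<forall>v \<in> B. u \<noteq> v \<longrightarrow> lt u v)}"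
  let ?P = "SIGMA z:N y. {x \<in> N y. lt z x}"
  let ?g = "card {z \<in> N y. y \<in> good z}"
  have "d y ^ 2 / real r ^ r \<le> real (card ?T)"
    using many_light[of "N y" 2] nbrs_subset_verts[OF simple] dy s by simp
  then have "2 * c * d y ^ 2 \<le> real (card ?T)" by (simp add: c_def)
  also have "card ?T \<le> card ?P"
  proof -
    have "?T \<subseteq> (\<lambda>(z, x). {z, x}) ` ?P"
    proof
      fix B assume B: "B \<in> ?T"
      then obtain u v where "B = {u, v}" "u \<noteq> v" by (auto simp: card_2_iff)
      then show "B \<in> (\<lambda>(z, x). {z, x}) ` ?P" using B by (intro image_eqI[of _ _ "(u, v)"]) auto
    qed
    moreover have "finite ?P" using finN by simp
    ultimately show ?thesis by (rule surj_card_le[rotated])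
  qed
  also have "card ?P = (\<Sum>z\<in>N y. ?f z)"
    using finN by simp
  also have "real (\<Sum>z\<in>N y. ?f z) \<le> (\<Sum>z\<in>N y. d y * of_bool (y \<in> good z) + c * d y)"
    unfolding of_nat_sum
  proof (rule sum_mono)
    fix z assume "z \<in> N y"
    then have yz: "y \<in> N z" using nbrs_sym by metis
    have "?f z \<le> card (N y)" using finN by (intro card_mono) auto
    moreover have "0 \<le> c * d y" using c_pos by simp
    ultimately show "real (?f z) \<le> d y * of_bool (y \<in> good z) + c * d y"
      using yz by (auto simp: good_def)
  qed
  also have "\<dots> = d y * ?g + c * d y ^ 2"
  proof -
    have "(\<Sum>z\<in>N y. of_bool (y \<in> good z)) = real ?g"
      by (simp add: sum_of_bool_eq finN Int_def)
    then show ?thesis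
      unfolding sum.distrib sum_distrib_left[symmetric] by (simp add: power2_eq_square)
  qed
  finally have "d y * (c * d y) \<le> d y * ?g"
    by (simp add: power2_eq_square algebra_simps)
  then show ?thesis
    using d_pos[OF y] by (simp only: mult_le_cancel_left_pos)
qed

lemma finite_good: "finite (good z)"
  using finN by (simp add: good_def)

text \<open>Double counting of the pairs \<open>(y, z)\<close> with \<open>y\<close> in
  \<open>good z\<close>, using \<open>card_good_ge\<close> at every \<open>y\<close>.\<close>

lemma sum_good_ge:
  assumes "real r \<le> \<delta>"
  shows "c * (\<Sum>v\<in>V. d v) \<le> (\<Sum>z\<in>V. real (card (good z)))"
proof -
  have "c * (\<Sum>v\<in>V. d v) \<le> (\<Sum>y\<in>V. real (card {z \<in> N y. y \<in> good z}))"
    unfolding sum_distrib_left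
  proof (rule sum_mono)
    fix y assume "y \<in> V"
    then show "c * d y \<le> real (card {z \<in> N y. y \<in> good z})"
      using card_good_ge[of y] degree[of y] assms by linarith
  qed
  also have "\<dots> = (\<Sum>y\<in>V. \<Sum>z\<in>V. of_bool (y \<in> good z))"
  proof (rule sum.cong)
    fix y assume "y \<in> V"
    have "{z \<in> N y. y \<in> good z} = V \<inter> {z. y \<in> good z}"
      using N_verts nbrs_sym[of y] by (auto simp: good_def)
    then show "real (card {z \<in> N y. y \<in> good z}) = (\<Sum>z\<in>V. of_bool (y \<in> good z))"
      using finV by (simp add: sum_of_bool_eq)
  qed simp
  also have "\<dots> = (\<Sum>z\<in>V. \<Sum>y\<in>V. of_bool (y \<in> good z))"
    by (rule sum.swap)
  also have "\<dots> = (\<Sum>z\<in>V. real (card (good z)))"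
  proof (rule sum.cong)
    fix z
    have "V \<inter> {y. y \<in> good z} = good z" using N_verts by (auto simp: good_def)
    then show "(\<Sum>y\<in>V. of_bool (y \<in> good z)) = real (card (good z))"
      using finV by (simp add: sum_of_bool_eq)
  qed simp
  finally show ?thesis .
qed

text \<open>Choose a pairwise light \<open>s\<close>-set among the good neighbours, then distinct
  feet light to \<open>z\<close>. The number of feet available at a middle is proportional to its
  degree, which cancels the degree of that middle in the weight.\<close>

lemma weight_at_center_ge:
  assumes z: "z \<in> V" and g: "r \<le> card (good z)" and large: "2 * s \<le> c * \<delta>"
  shows "d z * (real (card (good z)) / d z) ^ s * (2 * c * (c / 2) ^ s) \<le> (\<Sum>l\<in>spiders z. weight z l)"
proof -
  let ?B = "{B. B \<subseteq> good z \<and> card B = s \<and> (\<forall>u \<in> B. \<forall>v \<in> B. u \<noteq> v \<longrightarrow> lt u v)}"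
  \<comment> \<open>One arbitrary enumeration of each set is enough: it makes the map
    \<open>\<phi>\<close> below injective, and leaving out the other orders costs only a constant
    factor.\<close>
  define b where "b B = (SOME h. bij_betw h {..<s} B)" for B :: "'a set"
  have finB: "finite ?B" using finite_good[of z] by (auto intro: finite_subset[of _ "Pow (good z)"])
  have b: "bij_betw (b B) {..<s} B" if "B \<in> ?B" for B
  proof -
    have "finite B" using that finite_good[of z] finite_subset by blast
    then have "\<exists>h. bij_betw h {..<s} B"
      using that ex_bij_betw_nat_finite[of B] by (auto simp: atLeast0LessThan)
    then show ?thesis unfolding b_def by (rule someI_ex)
  qed
  define A where "A B i = {x \<in> N (b B i). lt z x}" for B i
  define X where "X B = {x \<in> Pi\<^sub>E {..<s} (A B). inj_on x {..<s}}" for B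
  define \<phi> where "\<phi> = (\<lambda>(B, x). \<lambda>i\<in>{..<s}. (b B i, x i :: 'a))"
  have finA: "finite (A B i)" for B i using finN by (simp add: A_def)
  have finX: "finite (X B)" for B
    unfolding X_def using finite_PiE[of "{..<s}" "A B"] finA by simp
  have bgood: "b B i \<in> good z" if "B \<in> ?B" "i < s" for B i
    using bij_betwE[OF b[OF that(1)]] that by blast
  have "d z * (real (card (good z)) / d z) ^ s * (2 * c * (c / 2) ^ s)
      = real (card (good z)) ^ s / real r ^ r * (d z * (c / 2 / d z) ^ s)"
  proof -
    have "(real (card (good z)) / d z) ^ s * (c / 2) ^ s = real (card (good z)) ^ s * (c / 2 / d z) ^ s"
      by (simp add: power_divide)
    moreover have "2 * c = 1 / real r ^ r" by (simp add: c_def)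
    ultimately show ?thesis by (simp add: mult_ac)
  qed
  also have "\<dots> \<le> real (card ?B) * (d z * (c / 2 / d z) ^ s)"
  proof (rule mult_right_mono)
    show "real (card (good z)) ^ s / real r ^ r \<le> real (card ?B)"
      using many_light[OF _ g, of s] N_verts by (auto simp: good_def)
  qed (use c_pos in simp)
  also have "\<dots> = (\<Sum>B\<in>?B. d z * (c / 2 / d z) ^ s)" by simp
  also have "\<dots> \<le> (\<Sum>B\<in>?B. \<Sum>x\<in>X B. weight z (\<phi> (B, x)))"
  proof (rule sum_mono)
    fix B assume B: "B \<in> ?B"
    have "(\<Prod>i<s. c / 2 * d (b B i)) \<le> (\<Prod>i<s. real (card (A B i) - s))"
    proof (rule prod_mono, intro conjI)
      fix i assume "i \<in> {..<s}"
      then have i: "b B i \<in> good z" using bgood[OF B] by simp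
      then have "c * d (b B i) \<le> card (A B i)" by (simp add: good_def A_def)
      \<comment> \<open>Since \<open>2 * s \<le> c * \<delta>\<close>, removing the at most
        \<open>s\<close> feet already used leaves at least half of the \<open>c * d (b B i)\<close>
        candidates.\<close>
      moreover have "c * \<delta> \<le> c * d (b B i)"
        using degree[of "b B i"] i c_pos N_verts by (intro mult_left_mono) (auto simp: good_def)
      ultimately show "c / 2 * d (b B i) \<le> real (card (A B i) - s)"
        using large by linarith
      show "0 \<le> c / 2 * d (b B i)" using c_pos by simp
    qed
    also have "\<dots> = real (\<Prod>i<s. card (A B i) - s)" by simp
    also have "\<dots> \<le> real (card (X B))"
      unfolding X_def of_nat_le_iff by (rule prod_diff_le_card_inj) (auto simp: finA)
    finally have X: "(\<Prod>i<s. c / 2 * d (b B i)) \<le> real (card (X B))" .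
    have "d z * (c / 2 / d z) ^ s = (\<Prod>i<s. c / 2 * d (b B i)) * (d z * (\<Prod>i<s. 1 / (d z * d (b B i))))"
    proof -
      have "(\<Prod>i<s. c / 2 * d (b B i)) * (\<Prod>i<s. 1 / (d z * d (b B i))) = (\<Prod>i<s. c / 2 / d z)"
        unfolding prod.distrib[symmetric]
      proof (rule prod.cong)
        fix i assume "i \<in> {..<s}"
        then have "0 < d (b B i)" using bgood[OF B] d_pos N_verts by (auto simp: good_def)
        then show "c / 2 * d (b B i) * (1 / (d z * d (b B i))) = c / 2 / d z" by simp
      qed simp
      then show ?thesis by (simp add: mult_ac)
    qed
    also have "\<dots> \<le> real (card (X B)) * (d z * (\<Prod>i<s. 1 / (d z * d (b B i))))"
      by (rule mult_right_mono[OF X]) (simp add: prod_nonneg)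
    also have "\<dots> = (\<Sum>x\<in>X B. weight z (\<phi> (B, x)))"
      by (simp add: weight_def \<phi>_def)
    finally show "d z * (c / 2 / d z) ^ s \<le> (\<Sum>x\<in>X B. weight z (\<phi> (B, x)))" .
  qed
  also have "\<dots> = (\<Sum>p\<in>Sigma ?B X. weight z (\<phi> p))"
    using finB finX by (subst sum.Sigma) (auto simp: case_prod_beta)
  also have "\<dots> = (\<Sum>l\<in>\<phi> ` Sigma ?B X. weight z l)"
  proof (rule sum.reindex_cong[symmetric, OF _ refl refl])
    show "inj_on \<phi> (Sigma ?B X)"
    proof (rule inj_onI)
      fix p q assume p: "p \<in> Sigma ?B X" and q: "q \<in> Sigma ?B X" and eq: "\<phi> p = \<phi> q"
      obtain B x B' x' where pq: "p = (B, x)" "q = (B', x')" by fastforce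
      have eqi: "b B i = b B' i \<and> x i = x' i" if "i < s" for i
        using fun_cong[OF eq, of i] that by (simp add: \<phi>_def pq)
      have "B = b B ` {..<s}" "B' = b B' ` {..<s}"
        using b p q pq by (auto simp: bij_betw_def)
      then have "B = B'" using eqi by (metis (no_types, lifting) image_cong lessThan_iff)
      moreover have "x = x'"
      proof (rule PiE_ext)
        show "x \<in> Pi\<^sub>E {..<s} (A B)" "x' \<in> Pi\<^sub>E {..<s} (A B)"
          using p q pq \<open>B = B'\<close> by (auto simp: X_def)
      qed (use eqi in auto)
      ultimately show "p = q" using pq by simp
    qed
  qed
  also have "\<dots> \<le> (\<Sum>l\<in>spiders z. weight z l)"
  proof (rule sum_mono2)
    show "\<phi> ` Sigma ?B X \<subseteq> spiders z"
    proof
      fix l assume "l \<in> \<phi> ` Sigma ?B X"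
      then obtain B x where B: "B \<in> ?B" and x: "x \<in> X B" and l: "l = (\<lambda>i\<in>{..<s}. (b B i, x i))"
        by (auto simp: \<phi>_def)
      have li: "l i = (b B i, x i)" if "i < s" for i using that by (simp add: l)
      have xi: "x i \<in> N (b B i)" "lt z (x i)" if "i < s" for i
        using x that by (auto simp: X_def A_def PiE_iff)
      have "l \<in> {..<s} \<rightarrow>\<^sub>E legs z"
        unfolding l legs_def using xi bgood[OF B] by (auto simp: good_def)
      moreover have "inj_on (snd \<circ> l) {..<s}"
      proof -
        have "inj_on x {..<s}" using x by (simp add: X_def)
        then show ?thesis using li by (auto simp: inj_on_def)
      qed
      moreover have "lt (b B i) (b B j)" if "i < s" "j < s" "i \<noteq> j" for i j
      proof -
        have "b B i \<in> B" "b B j \<in> B" "b B i \<noteq> b B j"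
          using b[OF B] that by (auto simp: bij_betw_def inj_on_def)
        then show ?thesis using B by blast
      qed
      ultimately show "l \<in> spiders z"
        unfolding spiders_def using li xi by auto
    qed
  qed (use finite_spiders weight_nonneg in auto)
  finally show ?thesis .
qed

text \<open>Centers whose good neighbours form less than a \<open>c / 2\<close> proportion
  contribute at most half of the bound in \<open>sum_good_ge\<close>. So the other centers,
  collected in \<open>Z\<close>, carry at least \<open>c / 2\<close> of the degree sum, and
  \<open>weight_at_center_ge\<close> applies to each of them.\<close>

lemma total_weight_ge:
  assumes "2 * s \<le> c * \<delta>" "2 * r \<le> c * \<delta>"
  shows "c\<^sup>2 * (c / 2) ^ (2 * s) * (\<Sum>v\<in>V. d v) \<le> (\<Sum>z\<in>V. \<Sum>l\<in>spiders z. weight z l)"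
proof -
  let ?E = "\<Sum>v\<in>V. d v"
  define Z where "Z = {z \<in> V. c / 2 * d z \<le> card (good z)}"
  have Z: "Z \<subseteq> V" "finite Z" using finV by (auto simp: Z_def)
  have good_le: "card (good z) \<le> d z" for z
    using finN by (auto simp: good_def intro: card_mono)
  \<comment> \<open>With \<open>2 * r \<le> c * \<delta>\<close> this yields
    \<open>r \<le> \<delta>\<close>, as \<open>sum_good_ge\<close> demands.\<close>
  have "c * \<delta> \<le> 1 * \<delta>" using c_le \<delta> by (intro mult_right_mono) auto
  then have "c * ?E \<le> (\<Sum>z\<in>V. real (card (good z)))"
    using assms by (intro sum_good_ge) linarith
  also have "\<dots> = (\<Sum>z\<in>Z. real (card (good z))) + (\<Sum>z\<in>V - Z. real (card (good z)))"
    by (subst sum.subset_diff[OF Z(1) finV]) simp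
  also have "(\<Sum>z\<in>V - Z. real (card (good z))) \<le> (\<Sum>z\<in>V - Z. c / 2 * d z)"
    by (rule sum_mono) (auto simp: Z_def)
  also have "\<dots> \<le> (\<Sum>z\<in>V. c / 2 * d z)"
    using c_pos finV by (intro sum_mono2) auto
  also have "\<dots> = c / 2 * ?E" by (simp add: sum_distrib_left)
  also have "(\<Sum>z\<in>Z. real (card (good z))) \<le> (\<Sum>z\<in>Z. d z)"
    by (rule sum_mono) (rule good_le)
  finally have EZ: "c / 2 * ?E \<le> (\<Sum>z\<in>Z. d z)" by simp
  have "c\<^sup>2 * (c / 2) ^ (2 * s) * ?E = c / 2 * ?E * (2 * c * (c / 2) ^ (2 * s))"
    by (simp add: power2_eq_square)
  also have "\<dots> \<le> (\<Sum>z\<in>Z. d z) * (2 * c * (c / 2) ^ (2 * s))"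
    using EZ c_pos by (intro mult_right_mono) auto
  also have "\<dots> = (\<Sum>z\<in>Z. d z * (2 * c * (c / 2) ^ (2 * s)))"
    by (simp add: sum_distrib_right)
  also have "\<dots> \<le> (\<Sum>z\<in>Z. \<Sum>l\<in>spiders z. weight z l)"
  proof (rule sum_mono)
    fix z assume "z \<in> Z"
    then have z: "z \<in> V" "c / 2 * d z \<le> card (good z)" by (auto simp: Z_def)
    have "c * \<delta> \<le> c * d z" using degree[OF z(1)] c_pos by (intro mult_left_mono) auto
    then have g: "r \<le> card (good z)" using z(2) assms(2) by linarith
    have "c / 2 \<le> real (card (good z)) / d z"
      using z d_pos by (simp add: le_divide_eq)
    then have "(c / 2) ^ s \<le> (real (card (good z)) / d z) ^ s"
      using c_pos by (intro power_mono) auto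
    then have "d z * (c / 2) ^ s * (2 * c * (c / 2) ^ s)
        \<le> d z * (real (card (good z)) / d z) ^ s * (2 * c * (c / 2) ^ s)"
      using c_pos by (intro mult_right_mono mult_left_mono) auto
    also have "\<dots> \<le> (\<Sum>l\<in>spiders z. weight z l)"
      using weight_at_center_ge[OF z(1) g assms(1)] .
    finally show "d z * (2 * c * (c / 2) ^ (2 * s)) \<le> (\<Sum>l\<in>spiders z. weight z l)"
      unfolding mult_2[of s] power_add by (simp only: mult_ac)
  qed
  also have "\<dots> \<le> (\<Sum>z\<in>V. \<Sum>l\<in>spiders z. weight z l)"
    using Z finV weight_nonneg by (intro sum_mono2) (auto intro: sum_nonneg)
  finally show ?thesis .
qed

end

subsection \<open>Rich and poor spiders\<close>

locale subdivision_free = light_graph +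
  fixes t :: nat
  assumes free: "\<not> contains_copy G (one_subdivision (complete_bipartite s t))"
begin

text \<open>The bound on \<open>U\<close> in \<open>contains_copy_if_extendable\<close>:
  \<open>s\<close> feet and \<open>t\<close> centers with \<open>s\<close> middles each.\<close>

definition m :: nat where "m = s + t * (s + 1)"

lemma not_extendable:
  assumes "inj_on x {..<s}" "x ` {..<s} \<subseteq> V"
    and "\<And>U. finite U \<Longrightarrow> card U \<le> m \<Longrightarrow> x ` {..<s} \<subseteq> U \<Longrightarrow>
      \<exists>z y. z \<notin> U \<and> inj_on y {..<s} \<and> (\<forall>i<s. y i \<notin> U \<and> y i \<in> N z \<inter> N (x i))"
  shows False
  using contains_copy_if_extendable[OF simple _ assms(1,2), of t] assms(3) free s
  unfolding m_def by force

text \<open>The foot \<open>x i\<close> does not enter, so it can later be exchanged for another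
  vertex. Of the middles \<open>y'\<close> only lightness to \<open>y\<close> is recorded, because
  it is \<open>y\<close> that stays fixed while the center varies.\<close>

definition centers :: "'a \<Rightarrow> (nat \<Rightarrow> 'a) \<Rightarrow> nat \<Rightarrow> 'a set" where
  "centers y x i = {z \<in> N y. \<exists>y'. inj_on y' ({..<s} - {i}) \<and>
     (\<forall>j \<in> {..<s} - {i}. y' j \<in> N z \<inter> N (x j) \<and> lt y (y' j))}"

text \<open>The threshold leaves a center outside any \<open>m\<close> given vertices and outside
  the common neighbourhoods of \<open>y\<close> with those of them that are light to
  \<open>y\<close>, each of size below \<open>C\<close>.\<close>

definition rich :: "'a \<Rightarrow> (nat \<Rightarrow> 'a) \<Rightarrow> nat \<Rightarrow> bool" where
  "rich y x i \<longleftrightarrow> m + m * C < card (centers y x i)"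

lemma rich_cong:
  assumes "\<And>j. j < s \<Longrightarrow> j \<noteq> i \<Longrightarrow> x j = x' j"
  shows "rich y x i \<longleftrightarrow> rich y x' i"
proof -
  have "centers y x i = centers y x' i"
    unfolding centers_def using assms by (intro Collect_cong conj_cong refl ex_cong1 ball_cong) auto
  then show ?thesis by (simp add: rich_def)
qed

lemma finite_centers: "finite (centers y x i)"
  using finN by (simp add: centers_def)

text \<open>With \<open>z\<close> as the \<open>i\<close>-th foot, every rich neighbour
  \<open>y\<close> of \<open>z\<close> can serve as the \<open>i\<close>-th middle under many
  different centers. More than \<open>m\<close> such \<open>y\<close> would always leave one outside
  \<open>U\<close>, so the embedding could be extended.\<close>

lemma card_rich_le:
  assumes z: "z \<in> V" and i: "i < s"
    and x: "inj_on x ({..<s} - {i})" "\<And>j. j < s \<Longrightarrow> j \<noteq> i \<Longrightarrow> x j \<in> V \<and> x j \<noteq> z"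
  shows "card {y \<in> N z. rich y x i} \<le> m"
proof (rule ccontr)
  assume many: "\<not> card {y \<in> N z. rich y x i} \<le> m"
  define w where "w = x(i := z)"
  show False
  proof (rule not_extendable[of w])
    have "z \<notin> x ` ({..<s} - {i})" using x(2) by auto
    then show "inj_on w {..<s}"
      using x(1) unfolding w_def inj_on_def by auto
    show "w ` {..<s} \<subseteq> V" using x(2) z by (auto simp: w_def)
    fix U assume U: "finite U" "card U \<le> m" "w ` {..<s} \<subseteq> U"
    have "\<not> {y \<in> N z. rich y x i} \<subseteq> U"
      using card_mono[OF U(1)] U(2) many by (meson le_trans)
    then obtain y where y: "y \<in> N z" "rich y x i" "y \<notin> U" by auto
    \<comment> \<open>A center outside \<open>T\<close> also keeps the other middles out of
      \<open>U\<close>: each of them is light to \<open>y\<close>, and the center is a common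
      neighbour of it and \<open>y\<close>.\<close>
    define T where "T = U \<union> (\<Union>u\<in>{u \<in> U. lt y u}. N y \<inter> N u)"
    have finT: "finite T" using U(1) finN by (simp add: T_def)
    have "card (\<Union>u\<in>{u \<in> U. lt y u}. N y \<inter> N u) \<le> (\<Sum>u\<in>{u \<in> U. lt y u}. card (N y \<inter> N u))"
      by (rule card_UN_le) (simp add: U(1))
    also have "\<dots> \<le> (\<Sum>u\<in>{u \<in> U. lt y u}. C)"
      by (rule sum_mono) (auto simp: light_def)
    also have "\<dots> = card {u \<in> U. lt y u} * C" by simp
    also have "\<dots> \<le> m * C"
      using card_mono[OF U(1), of "{u \<in> U. lt y u}"] U(2) by (intro mult_right_mono) auto
    finally have "card T \<le> m + m * C"
      using card_Un_le[of U "\<Union>u\<in>{u \<in> U. lt y u}. N y \<inter> N u"] U(2) unfolding T_def by linarith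
    then have "\<not> centers y x i \<subseteq> T"
      using card_mono[OF finT, of "centers y x i"] y(2) unfolding rich_def by linarith
    then obtain v where v: "v \<in> centers y x i" "v \<notin> T" by auto
    then obtain y' where y': "inj_on y' ({..<s} - {i})"
      "\<And>j. j \<in> {..<s} - {i} \<Longrightarrow> y' j \<in> N v \<inter> N (x j) \<and> lt y (y' j)" and vy: "v \<in> N y"
      by (auto simp: centers_def)
    have yv: "y \<in> N v" using vy nbrs_sym by metis
    show "\<exists>v y. v \<notin> U \<and> inj_on y {..<s} \<and> (\<forall>j<s. y j \<notin> U \<and> y j \<in> N v \<inter> N (w j))"
    proof (rule exI[of _ v], rule exI[of _ "y'(i := y)"], intro conjI allI impI)
      show "v \<notin> U" using v(2) by (simp add: T_def)
      have "y \<notin> y' ` ({..<s} - {i})" using y'(2) by (auto simp: light_def)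
      then show "inj_on (y'(i := y)) {..<s}"
        using y'(1) by (auto simp: inj_on_def)
      fix j assume j: "j < s"
      show "(y'(i := y)) j \<in> N v \<inter> N (w j)"
        using y'(2)[of j] j y(1) yv by (auto simp: w_def)
      show "(y'(i := y)) j \<notin> U"
      proof (cases "j = i")
        case False
        then have "y' j \<in> N v" "lt y (y' j)" using y'(2)[of j] j by auto
        then have "v \<in> N y \<inter> N (y' j)" using vy nbrs_sym by (metis IntI)
        then show ?thesis using False v(2) \<open>lt y (y' j)\<close> by (auto simp: T_def)
      qed (use y(3) in simp)
    qed
  qed
qed

section \<open>Counting poor spiders with given feet\<close>

text \<open>Each middle is a common neighbour of the center and a foot light to it, which leaves
  fewer than \<open>C\<close> choices.\<close>

lemma card_spiders_le:
  assumes x: "x \<in> {..<s} \<rightarrow>\<^sub>E V"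
  shows "card {l \<in> spiders z. \<forall>i<s. snd (l i) = x i} \<le> C ^ s"
proof (cases "\<forall>i<s. lt z (x i)")
  case True
  let ?P = "\<Pi>\<^sub>E i\<in>{..<s}. N z \<inter> N (x i)"
  have "card {l \<in> spiders z. \<forall>i<s. snd (l i) = x i} \<le> card ?P"
  proof (rule card_inj_on_le)
    show "inj_on (\<lambda>l. \<lambda>i\<in>{..<s}. fst (l i)) {l \<in> spiders z. \<forall>i<s. snd (l i) = x i}"
    proof (rule inj_onI)
      fix l l' assume l: "l \<in> {l \<in> spiders z. \<forall>i<s. snd (l i) = x i}"
        and l': "l' \<in> {l \<in> spiders z. \<forall>i<s. snd (l i) = x i}"
        and eq: "(\<lambda>i\<in>{..<s}. fst (l i)) = (\<lambda>i\<in>{..<s}. fst (l' i))"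
      show "l = l'"
      proof (rule PiE_ext)
        show "l \<in> {..<s} \<rightarrow>\<^sub>E legs z" "l' \<in> {..<s} \<rightarrow>\<^sub>E legs z"
          using l l' by (auto simp: spiders_def)
        fix i assume "i \<in> {..<s}"
        then show "l i = l' i"
          using fun_cong[OF eq, of i] l l' by (auto simp: prod_eq_iff)
      qed
    qed
    show "(\<lambda>l. \<lambda>i\<in>{..<s}. fst (l i)) ` {l \<in> spiders z. \<forall>i<s. snd (l i) = x i} \<subseteq> ?P"
    proof (rule image_subsetI)
      fix l assume l: "l \<in> {l \<in> spiders z. \<forall>i<s. snd (l i) = x i}"
      have "fst (l i) \<in> N z \<inter> N (x i)" if "i < s" for i
        using leg_mem(1,2)[of l z i] l that nbrs_sym by fastforce
      then show "(\<lambda>i\<in>{..<s}. fst (l i)) \<in> ?P" by simp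
    qed
    show "finite ?P" using finN by (intro finite_PiE) auto
  qed
  also have "card ?P = (\<Prod>i<s. card (N z \<inter> N (x i)))"
    by (rule card_PiE) simp
  also have "\<dots> \<le> (\<Prod>i<s. C)"
    using True by (intro prod_mono) (auto simp: light_def less_imp_le)
  finally show ?thesis by simp
next
  case False
  then have "{l \<in> spiders z. \<forall>i<s. snd (l i) = x i} = {}"
    by (auto simp: spiders_def)
  then show ?thesis by (metis card.empty le0)
qed

definition poor :: "(nat \<Rightarrow> 'a) \<Rightarrow> ('a \<times> (nat \<Rightarrow> 'a \<times> 'a)) set" where
  "poor x = {(z, l). z \<in> V \<and> l \<in> spiders z \<and> (\<forall>i<s. snd (l i) = x i) \<and> (\<forall>i<s. \<not> rich (fst (l i)) x i)}"

lemma finite_poor: "finite (poor x)"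
  by (rule finite_subset[of _ "Sigma V spiders"]) (auto simp: poor_def finV finite_spiders)

lemma card_poor_center_le:
  assumes x: "x \<in> {..<s} \<rightarrow>\<^sub>E V"
  shows "card {f \<in> poor x. fst f = z} \<le> C ^ s"
proof -
  have "{f \<in> poor x. fst f = z} \<subseteq> Pair z ` {l \<in> spiders z. \<forall>i<s. snd (l i) = x i}"
    by (auto simp: poor_def)
  then have "card {f \<in> poor x. fst f = z} \<le> card {l \<in> spiders z. \<forall>i<s. snd (l i) = x i}"
    using finite_spiders by (intro surj_card_le) auto
  then show ?thesis using card_spiders_le[OF x, of z] by linarith
qed

text \<open>If \<open>u\<close> is the \<open>i\<close>-th middle of a poor spider, its center
  belongs to \<open>centers u x i\<close>, which is small because \<open>u\<close> is not rich; each
  center has at most \<open>C ^ s\<close> spiders on these feet.\<close>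

lemma card_poor_middle_le:
  assumes x: "x \<in> {..<s} \<rightarrow>\<^sub>E V" and i: "i < s"
  shows "card {f \<in> poor x. fst (snd f i) = u} \<le> (m + m * C) * C ^ s"
proof (cases "rich u x i")
  case True
  then have "{f \<in> poor x. fst (snd f i) = u} = {}" using i by (auto simp: poor_def)
  then show ?thesis by (metis card.empty le0)
next
  case False
  have sub: "{f \<in> poor x. fst (snd f i) = u} \<subseteq> (\<Union>z\<in>centers u x i. {f \<in> poor x. fst f = z})"
  proof
    fix f assume f: "f \<in> {f \<in> poor x. fst (snd f i) = u}"
    obtain z l where zl: "f = (z, l)" by fastforce
    then have l: "l \<in> spiders z" and xl: "\<And>j. j < s \<Longrightarrow> snd (l j) = x j" and u: "fst (l i) = u"
      using f by (auto simp: poor_def)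
    have lt: "lt (fst (l j)) (fst (l k))" if "j < s" "k < s" "j \<noteq> k" for j k
      using l that by (auto simp: spiders_def)
    have "inj_on (\<lambda>j. fst (l j)) ({..<s} - {i})"
      by (rule inj_onI) (use lt in \<open>auto simp: light_def\<close>)
    moreover have "fst (l j) \<in> N z \<inter> N (x j) \<and> lt u (fst (l j))" if "j \<in> {..<s} - {i}" for j
      using leg_mem(1,2)[OF l, of j] that lt[OF i, of j] xl[of j] u nbrs_sym[of "x j"] by auto
    moreover have "z \<in> N u" using leg_mem(1)[OF l i] u nbrs_sym[of z] by auto
    ultimately have "z \<in> centers u x i" unfolding centers_def by blast
    then show "f \<in> (\<Union>z\<in>centers u x i. {f \<in> poor x. fst f = z})" using f zl by auto
  qed
  have "card {f \<in> poor x. fst (snd f i) = u} \<le> card (\<Union>z\<in>centers u x i. {f \<in> poor x. fst f = z})"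
    by (rule card_mono[OF _ sub]) (auto simp: finite_centers finite_poor)
  also have "\<dots> \<le> (\<Sum>z\<in>centers u x i. card {f \<in> poor x. fst f = z})"
    by (rule card_UN_le) (rule finite_centers)
  also have "\<dots> \<le> (\<Sum>z\<in>centers u x i. C ^ s)"
    by (rule sum_mono) (rule card_poor_center_le[OF x])
  also have "\<dots> = card (centers u x i) * C ^ s" by simp
  also have "\<dots> \<le> (m + m * C) * C ^ s"
    using False by (intro mult_right_mono) (auto simp: rich_def)
  finally show ?thesis .
qed

text \<open>A fixed vertex is the center or one of the \<open>s\<close> middles of only boundedly
  many poor spiders. Any \<open>m\<close> vertices thus block at most the stated number, and a
  further poor spider would extend the embedding.\<close>

lemma card_poor_le:
  assumes x: "x \<in> {..<s} \<rightarrow>\<^sub>E V"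
  shows "card (poor x) \<le> m * (C ^ s + s * ((m + m * C) * C ^ s))"
proof (rule ccontr)
  assume many: "\<not> card (poor x) \<le> m * (C ^ s + s * ((m + m * C) * C ^ s))"
  show False
  proof (rule not_extendable[of x])
    \<comment> \<open>The feet are distinct because at least one spider stands on them.\<close>
    have "poor x \<noteq> {}" using many by (metis card.empty le0)
    then obtain z l where l: "l \<in> spiders z" "\<And>i. i < s \<Longrightarrow> snd (l i) = x i" by (auto simp: poor_def)
    have "inj_on (snd \<circ> l) {..<s}" using l(1) by (simp add: spiders_def)
    then show "inj_on x {..<s}" using l(2) by (simp add: inj_on_def)
    show "x ` {..<s} \<subseteq> V" using x by auto
    fix U assume U: "finite U" "card U \<le> m" "x ` {..<s} \<subseteq> U"
    \<comment> \<open>The poor spiders using \<open>u\<close> as center or middle; the feet are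
      common to all of them and need no avoiding.\<close>
    define H where "H u = {f \<in> poor x. fst f = u} \<union> (\<Union>i<s. {f \<in> poor x. fst (snd f i) = u})" for u
    have H: "card (H u) \<le> C ^ s + s * ((m + m * C) * C ^ s)" for u
    proof -
      have "card (\<Union>i<s. {f \<in> poor x. fst (snd f i) = u}) \<le> (\<Sum>i<s. card {f \<in> poor x. fst (snd f i) = u})"
        by (rule card_UN_le) simp
      also have "\<dots> \<le> (\<Sum>i<s. (m + m * C) * C ^ s)"
        by (rule sum_mono) (rule card_poor_middle_le[OF x], simp)
      also have "\<dots> = s * ((m + m * C) * C ^ s)" by simp
      finally show ?thesis
        using card_poor_center_le[OF x, of u]
          card_Un_le[of "{f \<in> poor x. fst f = u}" "\<Union>i<s. {f \<in> poor x. fst (snd f i) = u}"]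
        unfolding H_def by linarith
    qed
    have "card (\<Union>u\<in>U. H u) \<le> (\<Sum>u\<in>U. card (H u))" by (rule card_UN_le[OF U(1)])
    also have "\<dots> \<le> (\<Sum>u\<in>U. C ^ s + s * ((m + m * C) * C ^ s))"
      by (rule sum_mono) (rule H)
    also have "\<dots> = card U * (C ^ s + s * ((m + m * C) * C ^ s))" by simp
    also have "\<dots> \<le> m * (C ^ s + s * ((m + m * C) * C ^ s))"
      by (rule mult_right_mono[OF U(2)]) simp
    finally have "card (\<Union>u\<in>U. H u) < card (poor x)" using many by linarith
    moreover have "finite (\<Union>u\<in>U. H u)" using U(1) finite_poor by (auto simp: H_def)
    ultimately have "\<not> poor x \<subseteq> (\<Union>u\<in>U. H u)" using card_mono leD by blast
    then obtain z l where f: "(z, l) \<in> poor x" "(z, l) \<notin> (\<Union>u\<in>U. H u)" by auto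
    then have l: "l \<in> spiders z" and xl: "\<And>j. j < s \<Longrightarrow> snd (l j) = x j" by (auto simp: poor_def)
    show "\<exists>z y. z \<notin> U \<and> inj_on y {..<s} \<and> (\<forall>i<s. y i \<notin> U \<and> y i \<in> N z \<inter> N (x i))"
    proof (rule exI[of _ z], rule exI[of _ "\<lambda>i. fst (l i)"], intro conjI allI impI)
      show "z \<notin> U" using f by (auto simp: H_def)
      show "inj_on (\<lambda>i. fst (l i)) {..<s}"
        by (rule inj_onI) (use l in \<open>auto simp: light_def spiders_def\<close>)
      fix i assume i: "i < s"
      show "fst (l i) \<notin> U" using f i by (auto simp: H_def)
      show "fst (l i) \<in> N z \<inter> N (x i)"
        using leg_mem(1,2)[OF l i] xl[OF i] nbrs_sym[of "x i"] by auto
    qed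
  qed
qed

text \<open>The leading \<open>d z\<close> cancels one of the \<open>s\<close> factors
  \<open>1 / d z\<close>, leaving \<open>2 * s - 1\<close> reciprocal degrees, each at most
  \<open>1 / \<delta>\<close>.\<close>

lemma weight_le:
  assumes z: "z \<in> V" and l: "l \<in> spiders z"
  shows "weight z l \<le> 1 / \<delta> ^ (2 * s - 1)"
proof -
  have dz: "0 < d z" using d_pos[OF z] .
  have "weight z l \<le> d z * (\<Prod>i<s. 1 / (d z * \<delta>))"
    unfolding weight_def
  proof (intro mult_left_mono prod_mono conjI)
    fix i assume "i \<in> {..<s}"
    then have "\<delta> \<le> d (fst (l i))" using leg_mem(3)[OF l, of i] degree by simp
    then show "1 / (d z * d (fst (l i))) \<le> 1 / (d z * \<delta>)"
      using dz \<delta> by (intro divide_left_mono) auto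
  qed auto
  also have "\<dots> = d z * (1 / (d z * \<delta>)) ^ s" by simp
  also have "\<dots> = (1 / d z) ^ (s - 1) * (1 / \<delta>) ^ s"
    using dz s by (cases s) (auto simp: field_simps)
  also have "\<dots> \<le> (1 / \<delta>) ^ (s - 1) * (1 / \<delta>) ^ s"
    using dz \<delta> degree[OF z] by (intro mult_right_mono power_mono divide_left_mono) auto
  also have "\<dots> = (1 / \<delta>) ^ (2 * s - 1)"
    using s by (simp flip: power_add) (metis Suc_1 Suc_leD diff_add_assoc2 mult_2)
  finally show ?thesis by (simp add: power_one_over)
qed

lemma poor_weight_le:
  "(\<Sum>x\<in>{..<s} \<rightarrow>\<^sub>E V. \<Sum>(z, l)\<in>poor x. weight z l)
     \<le> real (card V) ^ s * real (m * (C ^ s + s * ((m + m * C) * C ^ s))) / \<delta> ^ (2 * s - 1)"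
proof -
  let ?B = "m * (C ^ s + s * ((m + m * C) * C ^ s))"
  have "(\<Sum>x\<in>{..<s} \<rightarrow>\<^sub>E V. \<Sum>(z, l)\<in>poor x. weight z l) \<le> (\<Sum>x\<in>{..<s} \<rightarrow>\<^sub>E V. real ?B * (1 / \<delta> ^ (2 * s - 1)))"
  proof (rule sum_mono)
    fix x assume x: "x \<in> {..<s} \<rightarrow>\<^sub>E V"
    have "(\<Sum>(z, l)\<in>poor x. weight z l) \<le> (\<Sum>f\<in>poor x. 1 / \<delta> ^ (2 * s - 1))"
      by (rule sum_mono) (use weight_le in \<open>auto simp: poor_def\<close>)
    also have "\<dots> = real (card (poor x)) * (1 / \<delta> ^ (2 * s - 1))" by simp
    also have "\<dots> \<le> real ?B * (1 / \<delta> ^ (2 * s - 1))"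
      using \<delta> card_poor_le[OF x] by (intro mult_right_mono) (simp only: of_nat_le_iff, simp)
    finally show "(\<Sum>(z, l)\<in>poor x. weight z l) \<le> real ?B * (1 / \<delta> ^ (2 * s - 1))" .
  qed
  also have "\<dots> = real (card ({..<s} \<rightarrow>\<^sub>E V)) * (real ?B * (1 / \<delta> ^ (2 * s - 1)))"
    by (rule sum_constant)
  also have "real (card ({..<s} \<rightarrow>\<^sub>E V)) = real (card V) ^ s" by (simp add: card_PiE)
  finally show ?thesis by (simp only: times_divide_eq_right mult_1_right mult.assoc)
qed

end

subsection \<open>Comparing weights\<close>

context subdivision_free
begin

definition rich_spiders :: "nat \<Rightarrow> 'a \<Rightarrow> (nat \<Rightarrow> 'a \<times> 'a) set" where
  "rich_spiders i z = {l \<in> spiders z. rich (fst (l i)) (snd \<circ> l) i}"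

text \<open>Condition on all legs but the \<open>i\<close>-th: by \<open>card_rich_le\<close> at
  most \<open>m\<close> of the \<open>d z\<close> first steps are then rich, an event of probability
  at most \<open>m / \<delta>\<close>.\<close>

lemma rich_weight_at_center_le:
  assumes z: "z \<in> V" and i: "i < s"
  shows "(\<Sum>l\<in>rich_spiders i z. weight z l) \<le> d z * (m / \<delta>)"
proof -
  define J where "J = {..<s} - {i}"
  have J: "finite J" "i \<notin> J" "insert i J = {..<s}" using i by (auto simp: J_def)
  let ?S = "J \<rightarrow>\<^sub>E legs z"
  \<comment> \<open>Setting this empty when \<open>card_rich_le\<close> does not apply gives a bound
    for every family in \<open>?S\<close>, so that the sum over the full product space can be
    factorised.\<close>
  define R where "R l = (if inj_on (snd \<circ> l) J \<and> (\<forall>j\<in>J. snd (l j) \<noteq> z)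
      then {y \<in> N z. rich y (snd \<circ> l) i} else {})" for l :: "nat \<Rightarrow> 'a \<times> 'a"
  define F :: "(nat \<Rightarrow> 'a \<times> 'a) \<times> 'a \<times> 'a \<Rightarrow> real" where
    "F = (\<lambda>(l, p). d z * (\<Prod>j\<in>J. 1 / (d z * d (fst (l j)))) * (1 / (d z * d (fst p))))"
  have F_nonneg: "0 \<le> F q" for q
    by (simp add: F_def case_prod_beta prod_nonneg)
  have RN: "R l \<subseteq> N z" for l by (auto simp: R_def)
  have finS: "finite ?S" using J finite_legs by (intro finite_PiE) auto
  have finR: "finite (Sigma (R l) N)" for l
    using finN finite_subset[OF RN finN] by blast
  have card_R: "card (R l) \<le> m" if "l \<in> ?S" for l
  proof (cases "inj_on (snd \<circ> l) J \<and> (\<forall>j\<in>J. snd (l j) \<noteq> z)")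
    case True
    have "(snd \<circ> l) j \<in> V \<and> (snd \<circ> l) j \<noteq> z" if "j < s" "j \<noteq> i" for j
    proof -
      have "j \<in> J" using that by (simp add: J_def)
      then have "l j \<in> legs z" using \<open>l \<in> ?S\<close> by auto
      then show ?thesis using True \<open>j \<in> J\<close> N_verts by (auto simp: legs_def)
    qed
    then have "card {y \<in> N z. rich y (snd \<circ> l) i} \<le> m"
      using True by (intro card_rich_le[OF z i]) (auto simp: J_def)
    then show ?thesis using True by (simp add: R_def)
  next
    case False
    then have "R l = {}" unfolding R_def by (rule if_not_P)
    then show ?thesis by simp
  qed
  define \<psi> where "\<psi> l = (restrict l J, l i)" for l :: "nat \<Rightarrow> 'a \<times> 'a"
  have inj: "inj_on \<psi> (rich_spiders i z)"
  proof (rule inj_onI)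
    fix l l' assume l: "l \<in> rich_spiders i z" and l': "l' \<in> rich_spiders i z" and eq: "\<psi> l = \<psi> l'"
    show "l = l'"
    proof (rule PiE_ext)
      show "l \<in> {..<s} \<rightarrow>\<^sub>E legs z" "l' \<in> {..<s} \<rightarrow>\<^sub>E legs z"
        using l l' by (auto simp: rich_spiders_def spiders_def)
      fix j assume "j \<in> {..<s}"
      moreover have "restrict l J j = restrict l' J j" "l i = l' i" using eq by (auto simp: \<psi>_def)
      ultimately show "l j = l' j" unfolding J(3)[symmetric] by auto
    qed
  qed
  have weight_F: "weight z l = F (\<psi> l)" for l
  proof -
    have "(\<Prod>j<s. 1 / (d z * d (fst (l j)))) =
        (\<Prod>j\<in>J. 1 / (d z * d (fst (l j)))) * (1 / (d z * d (fst (l i))))"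
      unfolding J(3)[symmetric] using J(1,2) by simp
    moreover have "(\<Prod>j\<in>J. 1 / (d z * d (fst (restrict l J j)))) = (\<Prod>j\<in>J. 1 / (d z * d (fst (l j))))"
      by (rule prod.cong) auto
    ultimately show ?thesis by (simp add: weight_def F_def \<psi>_def)
  qed
  have sub: "\<psi> ` rich_spiders i z \<subseteq> Sigma ?S (\<lambda>l. Sigma (R l) N)"
  proof (rule image_subsetI)
    fix l assume l: "l \<in> rich_spiders i z"
    then have sp: "l \<in> spiders z" and ri: "rich (fst (l i)) (snd \<circ> l) i" by (auto simp: rich_spiders_def)
    have legs: "l j \<in> legs z" if "j < s" for j using sp that by (auto simp: spiders_def)
    have "restrict l J \<in> ?S" using legs by (auto simp: J_def)
    moreover have "inj_on (snd \<circ> restrict l J) J"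
    proof -
      have "inj_on (snd \<circ> l) J" using sp by (auto simp: spiders_def J_def intro: inj_on_subset)
      then show ?thesis by (simp add: inj_on_def)
    qed
    moreover have "\<forall>j\<in>J. snd (restrict l J j) \<noteq> z"
      using sp by (auto simp: spiders_def J_def light_def)
    moreover have "rich (fst (l i)) (snd \<circ> restrict l J) i"
      using ri by (subst rich_cong[of i _ "snd \<circ> l"]) (auto simp: J_def)
    ultimately have "restrict l J \<in> ?S" "fst (l i) \<in> R (restrict l J)"
      using leg_mem(1)[OF sp i] by (simp_all add: R_def)
    then have "(restrict l J, fst (l i), snd (l i)) \<in> Sigma ?S (\<lambda>l. Sigma (R l) N)"
      using leg_mem(2)[OF sp i] by (intro SigmaI)
    then show "\<psi> l \<in> Sigma ?S (\<lambda>l. Sigma (R l) N)" by (simp only: \<psi>_def prod.collapse)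
  qed
  have "(\<Sum>l\<in>rich_spiders i z. weight z l) = (\<Sum>q\<in>\<psi> ` rich_spiders i z. F q)"
    unfolding sum.reindex[OF inj] by (simp add: weight_F)
  also have "\<dots> \<le> (\<Sum>q\<in>Sigma ?S (\<lambda>l. Sigma (R l) N). F q)"
    using sub F_nonneg finS finR by (intro sum_mono2) auto
  also have "\<dots> = (\<Sum>l\<in>?S. \<Sum>p\<in>Sigma (R l) N. F (l, p))"
    using finS finR by (subst sum.Sigma) auto
  also have "\<dots> \<le> (\<Sum>l\<in>?S. d z * (m / \<delta>) * (\<Prod>j\<in>J. 1 / (d z * d (fst (l j)))))"
  proof (rule sum_mono)
    fix l assume l: "l \<in> ?S"
    let ?P = "\<Prod>j\<in>J. 1 / (d z * d (fst (l j)))"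
    have "(\<Sum>p\<in>Sigma (R l) N. F (l, p)) = d z * ?P * (card (R l) / d z)"
      unfolding F_def prod.case sum_distrib_left[symmetric] by (subst sum_legs[OF z RN]) simp
    also have "\<dots> \<le> d z * ?P * (m / \<delta>)"
      using card_R[OF l] degree[OF z] \<delta>
      by (intro mult_left_mono frac_le mult_nonneg_nonneg prod_nonneg) auto
    finally show "(\<Sum>p\<in>Sigma (R l) N. F (l, p)) \<le> d z * (m / \<delta>) * ?P" by (simp add: mult_ac)
  qed
  also have "\<dots> = d z * (m / \<delta>) * (\<Sum>l\<in>?S. \<Prod>j\<in>J. 1 / (d z * d (fst (l j))))"
    by (rule sum_distrib_left[symmetric])
  \<comment> \<open>The remaining legs range independently over \<open>legs z\<close>, and each
    contributes total probability 1.\<close>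
  also have "(\<Sum>l\<in>?S. \<Prod>j\<in>J. 1 / (d z * d (fst (l j)))) = (\<Prod>j\<in>J. \<Sum>p\<in>legs z. 1 / (d z * d (fst p)))"
    using J(1) finite_legs by (subst prod_sum_PiE) auto
  also have "(\<Sum>p\<in>legs z. 1 / (d z * d (fst p))) = 1"
    unfolding legs_def using d_pos[OF z] by (subst sum_legs[OF z subset_refl]) simp
  finally show ?thesis by simp
qed

text \<open>Every spider is poor or rich at some index. The poor ones are grouped by their feet, the
  rich ones are handled by a union bound over the index.\<close>

lemma total_weight_le:
  "(\<Sum>z\<in>V. \<Sum>l\<in>spiders z. weight z l)
     \<le> real (card V) ^ s * real (m * (C ^ s + s * ((m + m * C) * C ^ s))) / \<delta> ^ (2 * s - 1)
       + s * ((\<Sum>v\<in>V. d v) * (m / \<delta>))"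
proof -
  let ?T = "Sigma V spiders"
  define P where "P = {(z, l) \<in> ?T. \<forall>i<s. \<not> rich (fst (l i)) (snd \<circ> l) i}"
  define w where "w = (\<lambda>(z, l). weight z l)"
  have w: "0 \<le> w f" for f using weight_nonneg by (simp add: w_def case_prod_beta)
  have finT: "finite ?T" using finV finite_spiders by blast
  have PT: "P \<subseteq> ?T" by (auto simp: P_def)
  then have finP: "finite P" using finT by (rule finite_subset)
  have "(\<Sum>z\<in>V. \<Sum>l\<in>spiders z. weight z l) = (\<Sum>f\<in>?T. w f)"
    using finV finite_spiders by (subst sum.Sigma) (auto simp: w_def)
  \<comment> \<open>A spider rich at several indices is counted repeatedly, which is harmless as
    weights are nonnegative.\<close>
  also have "\<dots> \<le> (\<Sum>f\<in>?T. of_bool (f \<in> P) * w f + (\<Sum>i<s. of_bool (snd f \<in> rich_spiders i (fst f)) * w f))"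
  proof (rule sum_mono)
    fix f assume f: "f \<in> ?T"
    have nn: "0 \<le> (\<Sum>i<s. of_bool (snd f \<in> rich_spiders i (fst f)) * w f)"
      using w by (intro sum_nonneg) auto
    show "w f \<le> of_bool (f \<in> P) * w f + (\<Sum>i<s. of_bool (snd f \<in> rich_spiders i (fst f)) * w f)"
    proof (cases "f \<in> P")
      case True
      then show ?thesis using nn by simp
    next
      case False
      then obtain i where i: "i < s" "snd f \<in> rich_spiders i (fst f)"
        using f by (auto simp: P_def rich_spiders_def)
      have "of_bool (snd f \<in> rich_spiders i (fst f)) * w f
          \<le> (\<Sum>i<s. of_bool (snd f \<in> rich_spiders i (fst f)) * w f)"
        using i(1) w by (intro member_le_sum) auto
      then show ?thesis using i(2) False by simp
    qed
  qed
  also have "\<dots> = (\<Sum>f\<in>?T. of_bool (f \<in> P) * w f)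
      + (\<Sum>i<s. \<Sum>f\<in>?T. of_bool (snd f \<in> rich_spiders i (fst f)) * w f)"
    unfolding sum.distrib by (subst sum.swap) simp
  also have "(\<Sum>f\<in>?T. of_bool (f \<in> P) * w f) = (\<Sum>f\<in>P. w f)"
    using finT PT by (intro sum.mono_neutral_cong_right) auto
  \<comment> \<open>The restriction turns the feet into an extensional function, so that the
    grouping runs over a finite function space.\<close>
  also have "(\<Sum>f\<in>P. w f) = (\<Sum>x\<in>{..<s} \<rightarrow>\<^sub>E V. \<Sum>f\<in>{f \<in> P. restrict (snd \<circ> snd f) {..<s} = x}. w f)"
  proof (rule sum.group[symmetric, OF finP])
    show "finite ({..<s} \<rightarrow>\<^sub>E V)" using finV by (intro finite_PiE) auto
    show "(\<lambda>f. restrict (snd \<circ> snd f) {..<s}) ` P \<subseteq> {..<s} \<rightarrow>\<^sub>E V"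
    proof (rule image_subsetI)
      fix f assume "f \<in> P"
      then have "snd f \<in> spiders (fst f)" by (auto simp: P_def)
      then show "restrict (snd \<circ> snd f) {..<s} \<in> {..<s} \<rightarrow>\<^sub>E V"
        using leg_mem(4) by (simp add: restrict_PiE_iff)
    qed
  qed
  also have "\<dots> = (\<Sum>x\<in>{..<s} \<rightarrow>\<^sub>E V. \<Sum>(z, l)\<in>poor x. weight z l)"
  proof (rule sum.cong[OF refl])
    fix x assume x: "x \<in> {..<s} \<rightarrow>\<^sub>E V"
    have restr: "restrict (snd \<circ> l) {..<s} = x \<longleftrightarrow> (\<forall>i<s. snd (l i) = x i)" for l :: "nat \<Rightarrow> 'a \<times> 'a"
      using x by (auto simp: fun_eq_iff PiE_iff extensional_def)
    have rc: "rich y (snd \<circ> l) i \<longleftrightarrow> rich y x i" if "\<forall>i<s. snd (l i) = x i" for y i and l :: "nat \<Rightarrow> 'a \<times> 'a"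
      using that by (intro rich_cong) auto
    have "{f \<in> P. restrict (snd \<circ> snd f) {..<s} = x} = poor x"
      unfolding P_def poor_def using rc by (auto simp: restr)
    then show "(\<Sum>f\<in>{f \<in> P. restrict (snd \<circ> snd f) {..<s} = x}. w f) = (\<Sum>(z, l)\<in>poor x. weight z l)"
      by (simp add: w_def)
  qed
  also have "\<dots> \<le> real (card V) ^ s * real (m * (C ^ s + s * ((m + m * C) * C ^ s))) / \<delta> ^ (2 * s - 1)"
    by (rule poor_weight_le)
  also have "(\<Sum>i<s. \<Sum>f\<in>?T. of_bool (snd f \<in> rich_spiders i (fst f)) * w f) \<le> (\<Sum>i<s. (\<Sum>v\<in>V. d v) * (m / \<delta>))"
  proof (rule sum_mono)
    fix i assume i: "i \<in> {..<s}"
    have "(\<Sum>f\<in>?T. of_bool (snd f \<in> rich_spiders i (fst f)) * w f)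
        = (\<Sum>z\<in>V. \<Sum>l\<in>spiders z. of_bool (l \<in> rich_spiders i z) * weight z l)"
      using finV finite_spiders by (subst sum.Sigma) (auto simp: w_def case_prod_beta)
    also have "\<dots> = (\<Sum>z\<in>V. \<Sum>l\<in>rich_spiders i z. weight z l)"
      using finite_spiders by (intro sum.cong refl sum.mono_neutral_cong_right) (auto simp: rich_spiders_def)
    also have "\<dots> \<le> (\<Sum>z\<in>V. d z * (m / \<delta>))"
      using i by (intro sum_mono rich_weight_at_center_le) auto
    finally show "(\<Sum>f\<in>?T. of_bool (snd f \<in> rich_spiders i (fst f)) * w f) \<le> (\<Sum>v\<in>V. d v) * (m / \<delta>)"
      unfolding sum_distrib_right .
  qed
  finally show ?thesis by simp
qed

end

section \<open>From the weight comparison to the extremal number\<close>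

text \<open>For large \<open>\<delta>\<close> the rich spiders take up at most half of the lower
  bound for the total weight. The poor ones must supply the rest, and the degree sum is at least
  \<open>\<delta>\<close> times the number of vertices. The constants are fixed before the
  graph.\<close>

lemma min_degree_bound:
  assumes s: "2 \<le> s"
  obtains K \<delta>\<^sub>0 :: real where "0 \<le> K"
    "\<And>(G :: 'a graph) (\<delta> :: real). finite_simple_graph G \<Longrightarrow>
      \<not> contains_copy G (one_subdivision (complete_bipartite s t)) \<Longrightarrow> verts G \<noteq> {} \<Longrightarrow>
      (\<And>v. v \<in> verts G \<Longrightarrow> \<delta> \<le> card (nbrs G v)) \<Longrightarrow> \<delta>\<^sub>0 \<le> \<delta> \<Longrightarrow>
      \<delta> ^ (2 * s) \<le> K * real (card (verts G)) ^ (s - 1)"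
proof -
  define m where "m = s + t * (s + 1)"
  define C where "C = m + s + 1"
  define B where "B = m * (C ^ s + s * ((m + m * C) * C ^ s))"
  have "0 < s" using s by simp
  then obtain r where r: "0 < r" and many:
    "\<And>(G :: 'a graph) W k. finite_simple_graph G \<Longrightarrow>
       \<not> contains_copy G (one_subdivision (complete_bipartite s t)) \<Longrightarrow>
       W \<subseteq> verts G \<Longrightarrow> r \<le> card W \<Longrightarrow> k \<le> s \<Longrightarrow>
       real (card W) ^ k / real r ^ r \<le> real (card {B. B \<subseteq> W \<and> card B = k \<and>
         (\<forall>u \<in> B. \<forall>v \<in> B. u \<noteq> v \<longrightarrow> light G (s + t * (s + 1) + s + 1) u v)})"
    by (rule many_light_sets[where t = t]) blast
  note many = many[folded m_def, folded C_def]
  \<comment> \<open>This is the constant \<open>c\<close> of \<open>light_rich_graph\<close>, needed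
    here before any graph is given.\<close>
  define a where "a = 1 / (2 * real r ^ r)"
  define \<kappa> where "\<kappa> = a\<^sup>2 * (a / 2) ^ (2 * s)"
  have a: "0 < a" using r by (simp add: a_def)
  then have \<kappa>: "0 < \<kappa>" by (simp add: \<kappa>_def)
  \<comment> \<open>The entries ensure, in order, positivity, the two hypotheses of
    \<open>total_weight_ge\<close>, and that the rich term \<open>s * m / \<delta>\<close> is at
    most \<open>\<kappa> / 2\<close>.\<close>
  define \<delta>\<^sub>0 where "\<delta>\<^sub>0 = Max {1, 2 * s / a, 2 * r / a, 2 * s * m / \<kappa>}"
  have \<delta>\<^sub>0: "1 \<le> \<delta>\<^sub>0" "2 * s / a \<le> \<delta>\<^sub>0" "2 * r / a \<le> \<delta>\<^sub>0" "2 * s * m / \<kappa> \<le> \<delta>\<^sub>0"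
    by (simp_all add: \<delta>\<^sub>0_def)
  show ?thesis
  proof (rule that[of "2 * real B / \<kappa>" \<delta>\<^sub>0])
    show "0 \<le> 2 * real B / \<kappa>" using \<kappa> by auto
    fix G :: "'a graph" and \<delta> :: real
    assume simple: "finite_simple_graph G"
      and free: "\<not> contains_copy G (one_subdivision (complete_bipartite s t))"
      and ne: "verts G \<noteq> {}"
      and deg: "\<And>v. v \<in> verts G \<Longrightarrow> \<delta> \<le> card (nbrs G v)" and \<delta>_ge: "\<delta>\<^sub>0 \<le> \<delta>"
    have pos: "0 < \<delta>" using \<delta>_ge \<delta>\<^sub>0(1) by linarith
    interpret light_rich_graph G s C \<delta> r
      by unfold_locales (use simple s deg pos r many[OF simple free] in auto)
    interpret S: subdivision_free G s C \<delta> t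
      by unfold_locales (use free in auto)
    let ?n = "real (card (verts G))" and ?E = "\<Sum>v\<in>verts G. real (card (nbrs G v))"
    have n: "0 < ?n" using ne finV by (simp add: card_gt_0_iff)
    have "2 * s / a \<le> \<delta>" "2 * r / a \<le> \<delta>" "2 * s * m / \<kappa> \<le> \<delta>" using \<delta>_ge \<delta>\<^sub>0 by linarith+
    then have large: "2 * s \<le> a * \<delta>" "2 * r \<le> a * \<delta>" "2 * s * m \<le> \<kappa> * \<delta>"
      using a \<kappa> by (simp_all add: pos_divide_le_eq mult.commute)
    have E: "?n * \<delta> \<le> ?E"
      using sum_mono[of "verts G" "\<lambda>_. \<delta>" "\<lambda>v. real (card (nbrs G v))"] deg by simp
    have "\<kappa> * ?E \<le> ?n ^ s * real B / \<delta> ^ (2 * s - 1) + s * (?E * (m / \<delta>))"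
    proof -
      have "S.m = m" by (simp add: S.m_def m_def)
      moreover have "c = a" by (simp add: c_def a_def)
      ultimately show ?thesis
        using total_weight_ge S.total_weight_le large(1,2) unfolding \<kappa>_def B_def by force
    qed
    moreover have "s * (?E * (m / \<delta>)) \<le> \<kappa> / 2 * ?E"
    proof -
      have "s * m / \<delta> \<le> \<kappa> / 2" using large(3) pos by (simp add: pos_divide_le_eq)
      then have "s * m / \<delta> * ?E \<le> \<kappa> / 2 * ?E" by (intro mult_right_mono) (auto intro: sum_nonneg)
      then show ?thesis by (simp add: mult_ac)
    qed
    moreover have "\<kappa> / 2 * (?n * \<delta>) \<le> \<kappa> / 2 * ?E"
      using E \<kappa> by (intro mult_left_mono) auto
    ultimately have "\<kappa> / 2 * (?n * \<delta>) \<le> ?n ^ s * real B / \<delta> ^ (2 * s - 1)" by linarith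
    then have "\<kappa> / 2 * (?n * \<delta>) * \<delta> ^ (2 * s - 1) \<le> ?n ^ s * real B"
      using pos by (simp add: pos_le_divide_eq)
    moreover have "\<delta> ^ (2 * s) = \<delta> * \<delta> ^ (2 * s - 1)" "?n ^ s = ?n * ?n ^ (s - 1)"
      using s by (simp_all flip: power_Suc)
    ultimately have "?n * (\<kappa> / 2 * \<delta> ^ (2 * s)) \<le> ?n * (?n ^ (s - 1) * real B)"
      by (simp only: mult_ac)
    then have "\<kappa> / 2 * \<delta> ^ (2 * s) \<le> ?n ^ (s - 1) * real B"
      using n by (simp only: mult_le_cancel_left_pos)
    then show "\<delta> ^ (2 * s) \<le> 2 * real B / \<kappa> * ?n ^ (s - 1)"
      using \<kappa> by (simp add: field_simps)
  qed
qed

lemma contains_copy_mono: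
  assumes "contains_copy H F" "verts H \<subseteq> verts G" "edges H \<subseteq> edges G"
  shows "contains_copy G F"
proof -
  obtain f where "inj_on f (verts F)" "f ` verts F \<subseteq> verts H" "\<forall>e \<in> edges F. f ` e \<in> edges H"
    using assms(1) unfolding contains_copy_def by auto
  then show ?thesis
    using assms(2,3) unfolding contains_copy_def by (intro exI[of _ f]) auto
qed

text \<open>Too many edges would give a subgraph \<open>H\<close> of minimum degree at least
  \<open>k\<close>, the edge bound divided by the number of vertices. Then
  \<open>k ^ (2 * s)\<close> contradicts \<open>min_degree_bound\<close>, where the order of
  \<open>H\<close> is at most that of \<open>G\<close>.\<close>

lemma card_edges_bound:
  assumes s: "2 \<le> s"
  obtains L :: real where
    "\<And>G :: 'a graph. finite_simple_graph G \<Longrightarrow> verts G \<noteq> {} \<Longrightarrow>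
      \<not> contains_copy G (one_subdivision (complete_bipartite s t)) \<Longrightarrow>
      card (edges G) \<le> L * real (card (verts G)) powr (3 / 2 - 1 / (2 * real s))"
proof (rule min_degree_bound[OF s, where t = t and 'a = 'a])
  fix \<delta>\<^sub>0 K :: real
  assume "0 \<le> K" and bound:
    "\<And>(G :: 'a graph) (\<delta> :: real). finite_simple_graph G \<Longrightarrow>
      \<not> contains_copy G (one_subdivision (complete_bipartite s t)) \<Longrightarrow> verts G \<noteq> {} \<Longrightarrow>
      (\<And>v. v \<in> verts G \<Longrightarrow> \<delta> \<le> card (nbrs G v)) \<Longrightarrow> \<delta>\<^sub>0 \<le> \<delta> \<Longrightarrow>
      \<delta> ^ (2 * s) \<le> K * real (card (verts G)) ^ (s - 1)"
  \<comment> \<open>The first entry makes \<open>k\<close> reach \<open>\<delta>\<^sub>0\<close>;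
    the second gives \<open>K < L \<le> L ^ (2 * s)\<close>.\<close>
  define L where "L = max \<delta>\<^sub>0 (K + 1)"
  have L: "\<delta>\<^sub>0 \<le> L" "K < L" "1 \<le> L" using \<open>0 \<le> K\<close> unfolding L_def by linarith+
  show ?thesis
  proof (rule that[of L], rule ccontr)
    fix G :: "'a graph"
    assume simple: "finite_simple_graph G" and ne: "verts G \<noteq> {}"
      and free: "\<not> contains_copy G (one_subdivision (complete_bipartite s t))"
      and many: "\<not> card (edges G) \<le> L * real (card (verts G)) powr (3 / 2 - 1 / (2 * real s))"
    define n where "n = real (card (verts G))"
    have finV: "finite (verts G)" using simple by (simp add: finite_simple_graph_def)
    have n: "1 \<le> n" using ne finV by (simp add: n_def card_gt_0_iff Suc_le_eq)
    define k where "k = L * n powr (1 / 2 - 1 / (2 * real s))"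
    have "k * n = L * n powr (3 / 2 - 1 / (2 * real s))"
      using n powr_add[of n "1 / 2 - 1 / (2 * real s)" 1] by (simp add: k_def algebra_simps)
    then have "k * card (verts G) < card (edges G)" using many by (simp add: n_def)
    moreover have "0 \<le> k" using L by (simp add: k_def)
    ultimately obtain H where H: "finite_simple_graph H" "verts H \<subseteq> verts G" "edges H \<subseteq> edges G"
      "verts H \<noteq> {}" "\<forall>v \<in> verts H. k \<le> card (nbrs H v)"
      using min_degree_subgraph[OF simple] by blast
    have "1 / (2 * real s) \<le> 1 / 2" using s by (intro divide_left_mono) auto
    then have "1 \<le> n powr (1 / 2 - 1 / (2 * real s))" using n by (intro ge_one_powr_ge_zero) auto
    then have "L * 1 \<le> k" using L unfolding k_def by (intro mult_left_mono) auto
    then have "\<delta>\<^sub>0 \<le> k" using L by linarith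
    moreover have "\<not> contains_copy H (one_subdivision (complete_bipartite s t))"
      using free contains_copy_mono[OF _ H(2,3)] by blast
    ultimately have "k ^ (2 * s) \<le> K * real (card (verts H)) ^ (s - 1)"
      using H(1,4,5) by (intro bound) auto
    also have "\<dots> \<le> K * n ^ (s - 1)"
      using card_mono[OF finV H(2)] \<open>0 \<le> K\<close> by (intro mult_left_mono power_mono) (auto simp: n_def)
    also have "\<dots> < L * n ^ (s - 1)" using L n by (intro mult_strict_right_mono) auto
    also have "\<dots> \<le> L ^ (2 * s) * n ^ (s - 1)"
      using L n s self_le_power[of L "2 * s"] by (intro mult_right_mono) auto
    also have "\<dots> = k ^ (2 * s)"
    proof -
      have "(n powr (1 / 2 - 1 / (2 * real s))) ^ (2 * s) = n powr ((1 / 2 - 1 / (2 * real s)) * real (2 * s))"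
        using n by (subst powr_realpow[symmetric]) (auto simp: powr_powr)
      also have "(1 / 2 - 1 / (2 * real s)) * real (2 * s) = real (s - 1)"
        using s by (simp add: field_simps of_nat_diff)
      also have "n powr real (s - 1) = n ^ (s - 1)" using n by (intro powr_realpow) auto
      finally show ?thesis by (simp add: k_def power_mult_distrib)
    qed
    finally show False by simp
  qed
qed

theorem theorem1p8:
  fixes s t :: nat
  assumes "2 \<le> s" and "s \<le> t"
  shows "(\<lambda>n. real (ex_number n (one_subdivision (complete_bipartite s t))))
           \<in> O(\<lambda>n. real n powr (3 / 2 - 1 / (2 * real s)))"
proof -
  let ?F = "one_subdivision (complete_bipartite s t)"
  show ?thesis
  proof (rule card_edges_bound[OF assms(1), where t = t and 'a = nat])
    fix L :: real assume L: "\<And>G :: nat graph. finite_simple_graph G \<Longrightarrow> verts G \<noteq> {} \<Longrightarrow>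
        \<not> contains_copy G ?F \<Longrightarrow>
        card (edges G) \<le> L * real (card (verts G)) powr (3 / 2 - 1 / (2 * real s))"
    \<comment> \<open>The bound is applied to an extremal graph; \<open>n\<close> is positive
      because \<open>L\<close> concerns nonempty graphs. That the maximum is attained requires the
      set of edge counts to be finite and nonempty.\<close>
    have "real (ex_number n ?F) \<le> L * real n powr (3 / 2 - 1 / (2 * real s))" if n: "1 \<le> n" for n
    proof -
      let ?M = "{card (edges G) | G :: nat graph.
              finite_simple_graph G \<and> card (verts G) = n \<and> \<not> contains_copy G ?F}"
      have "?M \<subseteq> {..2 ^ n}"
      proof
        fix e assume "e \<in> ?M"
        then obtain G :: "nat graph" where G: "e = card (edges G)" "finite_simple_graph G" "card (verts G) = n"
          by blast
        then have "edges G \<subseteq> Pow (verts G)" "finite (verts G)" by (auto simp: finite_simple_graph_def)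
        then have "card (edges G) \<le> 2 ^ n" using card_mono[of "Pow (verts G)"] G(3) by (simp add: card_Pow)
        then show "e \<in> {..2 ^ n}" using G(1) by simp
      qed
      then have "finite ?M" by (rule finite_subset) simp
      moreover have "0 \<in> ?M"
      proof -
        \<comment> \<open>As \<open>s\<close> and \<open>t\<close> are positive, the subdivision has
          an edge, so an edgeless graph contains no copy of it.\<close>
        have "{Inl (Inl 0), Inr {Inl 0, Inr 0}} \<in> edges ?F"
          using assms unfolding one_subdivision_def complete_bipartite_def snd_conv mem_Collect_eq
          by (intro exI[of _ "Inl 0"] exI[of _ "{Inl 0, Inr 0}"] exI[of _ 0] conjI) auto
        then have "\<not> contains_copy ({..<n}, {}) ?F" by (auto simp: contains_copy_def)
        then show ?thesis
          by (intro CollectI exI[of _ "({..<n}, {})"]) (auto simp: finite_simple_graph_def)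
      qed
      ultimately have "ex_number n ?F \<in> ?M" unfolding ex_number_def by (intro Max_in) auto
      then obtain G :: "nat graph" where G: "ex_number n ?F = card (edges G)" "finite_simple_graph G"
        "card (verts G) = n" "\<not> contains_copy G ?F" by blast
      then have "verts G \<noteq> {}" using n by auto
      then show ?thesis using L[OF G(2) _ G(4)] G by simp
    qed
    then show "(\<lambda>n. real (ex_number n ?F)) \<in> O(\<lambda>n. real n powr (3 / 2 - 1 / (2 * real s)))"
      by (intro bigoI[of _ L] eventually_sequentiallyI[of 1]) auto
  qed
qed

end
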